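(* Let $d,n,B\ge1$ be integers, $\Psi:\mathbb{R}^d\to\mathbb{R}^n$ a nonzero linear operator, $y\in\mathbb{R}^n$, $\tau>0$, $p\in(1,+\infty]$, and $\mathcal{G}=\{G_r\}_{r=1}^{B}$ with $G_r\subset\{1,\dots,d\}$ and $\bigcup_{r=1}^{B}G_r=\{1,\dots,d\}$. Let $$\mathcal{E}^p_\tau(x)=\frac1n\|\Psi x-y\|^2+2\tau\,\Omega^{\mathcal{G}}_p(x),\qquad x\in\mathbb{R}^d,$$ and let $x^*$ be a minimizer of $\mathcal{E}^p_\tau$ on $\mathbb{R}^d$. Let $x^0\in\mathbb{R}^d$, $\sigma=\|\Psi^T\Psi\|/n$, $\epsilon_0>0$, $\alpha>0$, and assume that at each step $m\ge1$ of the iterations (inexact ISTA and inexact FISTA, defined in the context) the projection onto $\frac{\tau}{\sigma}K_p^{\mathcal{G}}$ is approximately computed with tolerance $\epsilon_m=\epsilon_0/m^{\alpha}$. (1) If $\alpha>2$, there exists a constant $C_I$, depending on $p,\mathcal{G},x^0,\sigma,\tau,\alpha$ (and on the fixed data $\Psi,y,\epsilon_0$) but not on $m$ nor on the iterates, such that every sequence $(x^m)_{m\ge1}$ generated by inexact ISTA satisfies, for all $m\ge1$, $$\mathcal{E}^p_\tau\left(\frac1m\sum_{i=1}^{m}x^i\right)-\mathcal{E}^p_\tau(x^* )\le\frac{C_I}{m}.$$ (2) If $\alpha>4$, there exists a constant $C_F$, depending on $p,\mathcal{G},x^0,\sigma,\tau,\alpha$ (and on the fixed data $\Psi,y,\epsilon_0$)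 but not on $m$ nor on the iterates, such that every sequence $(x^m)_{m\ge1}$ generated by inexact FISTA satisfies, for all $m\ge1$, $$\mathcal{E}^p_\tau(x^m)-\mathcal{E}^p_\tau(x^* )\le\frac{C_F}{m^2}.$$
   Context: Norms: $\|\cdot\|$ is the Euclidean norm on vectors, $\|\Psi^T\Psi\|$ is the operator norm; $q$ is the conjugate exponent of $p$, $1/p+1/q=1$ ($q=1$ if $p=+\infty$). For $G\subset\{1,\dots,d\}$, $\|x\|_{G,q}=(\sum_{j\in G}|x_j|^q)^{1/q}$. Penalty: for each $r$, $P_r^*:\mathbb{R}^{G_r}\to\mathbb{R}^d$ is the canonical injection (extension by zero), $P^*(v_1,\dots,v_B)=\sum_{r=1}^{B}P_r^*v_r$, and $$\Omega^{\mathcal{G}}_p(x)=\min\Big\{\sum_{r=1}^{B}\|v_r\|_p:\ v\in\prod_{r=1}^{B}\mathbb{R}^{G_r},\ P^*v=x\Big\}.$$ Set: $K_p^{\mathcal{G}}=\{x\in\mathbb{R}^d:\|x\|_{G_r,q}\le1,\ r=1,\dots,B\}$, and $\pi_{\frac{\tau}{\sigma}K_p^{\mathcal{G}}}$ is the Euclidean projection onto $\frac{\tau}{\sigma}K_p^{\mathcal{G}}$. The exact proximity operator of $\frac{\tau}{\sigma}\Omega^{\mathcal{G}}_p$ is $I-\pi_{\frac{\tau}{\sigma}K_p^{\mathcal{G}}}$. Approximate projection: $w$ is an approximation of $\pi_{\frac{\tau}{\sigma}K_p^{\mathcal{G}}}(z)$ with tolerance $\epsilon$ if $\|w-\pi_{\frac{\tau}{\sigma}K_p^{\mathcal{G}}}(z)\|\le\epsilon$.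 Inexact ISTA (starting from $x^0$): for $m\ge1$, set $\hat h^m=x^{m-1}-\frac{1}{n\sigma}\Psi^T(\Psi x^{m-1}-y)$, let $w^m$ be any approximation of $\pi_{\frac{\tau}{\sigma}K_p^{\mathcal{G}}}(\hat h^m)$ with tolerance $\epsilon_m$, and set $x^m=\hat h^m-w^m$. Inexact FISTA (starting from $h^1=x^0$, $s_1=1$): for $m\ge1$, set $\hat h^m=h^m-\frac{1}{n\sigma}\Psi^T(\Psi h^m-y)$, let $w^m$ be any approximation of $\pi_{\frac{\tau}{\sigma}K_p^{\mathcal{G}}}(\hat h^m)$ with tolerance $\epsilon_m$, and set $$x^m=\hat h^m-w^m,\qquad s_{m+1}=\tfrac12\left(1+\sqrt{1+4s_m^2}\right),\qquad h^{m+1}=\left(1+\frac{s_m-1}{s_{m+1}}\right)x^m+\frac{1-s_m}{s_{m+1}}x^{m-1}.$$ *)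

theory Defs
  imports "HOL-Analysis.Analysis"
begin

text \<open>
  Coordinates are indexed by a finite type \<open>'d\<close> (dimension \<open>CARD('d)\<close>), observations by \<open>'n\<close>,
  and the groups \<open>G r\<close> by a finite type \<open>'b\<close>; groups may overlap, coincide or be empty.
\<close>

text \<open>
  The \<open>\<ell>\<^sup>p\<close> norm of the restriction of \<open>f\<close> to the index set \<open>S\<close>.
  The inserted \<open>0\<close> only matters for \<open>S = {}\<close>.
\<close>

definition lp_norm :: "ereal \<Rightarrow> 'd::finite set \<Rightarrow> ('d \<Rightarrow> real) \<Rightarrow> real" where
  "lp_norm p S f =
    (if p = \<infinity> then Max (insert 0 ((\<lambda>j. \<bar>f j\<bar>) ` S))
     else (\<Sum>j\<in>S. \<bar>f j\<bar> powr real_of_ereal p) powr (1 / real_of_ereal p))"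

text \<open>
  The space \<open>\<real>\<^sup>S\<close> for a subset \<open>S\<close> of the coordinates is \<open>S \<rightarrow>\<^sub>E UNIV\<close>;
  \<open>zero_ext S\<close> is its canonical injection into the full space.
\<close>

definition zero_ext :: "'d::finite set \<Rightarrow> ('d \<Rightarrow> real) \<Rightarrow> real^'d" where
  "zero_ext S f = (\<chi> j. if j \<in> S then f j else 0)"

definition P_star :: "('b::finite \<Rightarrow> 'd::finite set) \<Rightarrow> ('b \<Rightarrow> 'd \<Rightarrow> real) \<Rightarrow> real^'d" where
  "P_star G v = (\<Sum>r\<in>UNIV. zero_ext (G r) (v r))"

definition decompositions ::
    "('b::finite \<Rightarrow> 'd::finite set) \<Rightarrow> real^'d \<Rightarrow> ('b \<Rightarrow> 'd \<Rightarrow> real) set" where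
  "decompositions G x = {v. (\<forall>r. v r \<in> G r \<rightarrow>\<^sub>E UNIV) \<and> P_star G v = x}"

text \<open>
  The infimum is a minimum whenever the groups cover all coordinates; see \<open>Omega_attained\<close>.
\<close>

definition Omega :: "ereal \<Rightarrow> ('b::finite \<Rightarrow> 'd::finite set) \<Rightarrow> real^'d \<Rightarrow> real" where
  "Omega p G x = (INF v\<in>decompositions G x. \<Sum>r\<in>UNIV. lp_norm p (G r) (v r))"

definition K_set :: "ereal \<Rightarrow> ('b::finite \<Rightarrow> 'd::finite set) \<Rightarrow> (real^'d) set" where
  "K_set q G = {x. \<forall>r. lp_norm q (G r) (($) x) \<le> 1}"

definition energy ::
    "(real^'d::finite \<Rightarrow> real^'n::finite) \<Rightarrow> real^'n \<Rightarrow> real \<Rightarrow> ereal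
      \<Rightarrow> ('b::finite \<Rightarrow> 'd set) \<Rightarrow> real^'d \<Rightarrow> real" where
  "energy \<Psi> y \<tau> p G x =
    1 / real CARD('n) * (norm (\<Psi> x - y))\<^sup>2 + 2 * \<tau> * Omega p G x"

definition step_const :: "(real^'d::finite \<Rightarrow> real^'n::finite) \<Rightarrow> real" where
  "step_const \<Psi> = onorm (adjoint \<Psi> \<circ> \<Psi>) / real CARD('n)"

definition grad_step ::
    "(real^'d::finite \<Rightarrow> real^'n::finite) \<Rightarrow> real^'n \<Rightarrow> real \<Rightarrow> real^'d \<Rightarrow> real^'d" where
  "grad_step \<Psi> y \<sigma> x = x - (1 / (real CARD('n) * \<sigma>)) *\<^sub>R adjoint \<Psi> (\<Psi> x - y)"

definition approx_projection ::
    "(real^'d::finite) set \<Rightarrow> real^'d \<Rightarrow> real \<Rightarrow> real^'d \<Rightarrow> bool" where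
  "approx_projection C z \<epsilon> w \<longleftrightarrow> norm (w - closest_point C z) \<le> \<epsilon>"

text \<open>
  The predicates below relate the data to all possible outputs \<open>x\<close>: the approximate projections
  \<open>w\<close> are arbitrary within the tolerances \<open>\<epsilon> m\<close>. The parameter \<open>q\<close> is the exponent
  conjugate to the one in the penalty.
\<close>

definition inexact_ISTA ::
    "(real^'d::finite \<Rightarrow> real^'n::finite) \<Rightarrow> real^'n \<Rightarrow> real \<Rightarrow> real \<Rightarrow> ereal
      \<Rightarrow> ('b::finite \<Rightarrow> 'd set) \<Rightarrow> (nat \<Rightarrow> real) \<Rightarrow> real^'d \<Rightarrow> (nat \<Rightarrow> real^'d) \<Rightarrow> bool" where
  "inexact_ISTA \<Psi> y \<tau> \<sigma> q G \<epsilon> x0 x \<longleftrightarrow>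
    x 0 = x0 \<and>
    (\<exists>w. \<forall>m\<ge>1.
      let z = grad_step \<Psi> y \<sigma> (x (m - 1)) in
        approx_projection ((*\<^sub>R) (\<tau> / \<sigma>) ` K_set q G) z (\<epsilon> m) (w m) \<and>
        x m = z - w m)"

definition inexact_FISTA ::
    "(real^'d::finite \<Rightarrow> real^'n::finite) \<Rightarrow> real^'n \<Rightarrow> real \<Rightarrow> real \<Rightarrow> ereal
      \<Rightarrow> ('b::finite \<Rightarrow> 'd set) \<Rightarrow> (nat \<Rightarrow> real) \<Rightarrow> real^'d \<Rightarrow> (nat \<Rightarrow> real^'d) \<Rightarrow> bool" where
  "inexact_FISTA \<Psi> y \<tau> \<sigma> q G \<epsilon> x0 x \<longleftrightarrow>
    x 0 = x0 \<and>
    (\<exists>w h s. h 1 = x0 \<and> s 1 = (1::real) \<and>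
      (\<forall>m\<ge>1.
        let z = grad_step \<Psi> y \<sigma> (h m) in
          approx_projection ((*\<^sub>R) (\<tau> / \<sigma>) ` K_set q G) z (\<epsilon> m) (w m) \<and>
          x m = z - w m \<and>
          s (m + 1) = (1 + sqrt (1 + 4 * (s m)\<^sup>2)) / 2 \<and>
          h (m + 1) = (1 + (s m - 1) / s (m + 1)) *\<^sub>R x m
                      + ((1 - s m) / s (m + 1)) *\<^sub>R x (m - 1)))"

lemma lp_norm_cong: "(\<And>j. j \<in> S \<Longrightarrow> f j = g j) \<Longrightarrow> lp_norm p S f = lp_norm p S g"
  unfolding lp_norm_def by (simp cong: image_cong sum.cong)

lemma lp_norm_nonneg: "0 \<le> lp_norm p S f"
  unfolding lp_norm_def by (auto intro!: Max_ge)

lemma abs_le_lp_norm: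
  assumes "1 \<le> p" "j \<in> S"
  shows "\<bar>f j\<bar> \<le> lp_norm p S f"
proof (cases p)
  case (real t)
  then have t: "t \<ge> 1" using assms by simp
  have "\<bar>f j\<bar> = (\<bar>f j\<bar> powr t) powr (1 / t)"
    using t by (simp add: powr_powr)
  also have "\<dots> \<le> (\<Sum>j\<in>S. \<bar>f j\<bar> powr t) powr (1 / t)"
    using t assms(2) by (intro powr_mono2 member_le_sum) auto
  finally show ?thesis using real by (simp add: lp_norm_def)
next
  case PInf
  then show ?thesis using assms(2) by (auto simp: lp_norm_def intro!: Max_ge)
qed (use assms(1) in simp)

lemma continuous_on_lp_norm:
  fixes f :: "'a::topological_space \<Rightarrow> 'd::finite \<Rightarrow> real"
  assumes "1 \<le> p" and f: "\<And>j. continuous_on A (\<lambda>x. f x j)"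
  shows "continuous_on A (\<lambda>x. lp_norm p S (f x))"
proof (cases p)
  case (real t)
  then have t: "t \<ge> 1" using assms by simp
  have "continuous_on A (\<lambda>x. (\<Sum>j\<in>S. \<bar>f x j\<bar> powr t) powr (1 / t))"
    using t by (intro continuous_on_powr' continuous_intros f ballI conjI)
      (auto intro!: sum_nonneg)
  then show ?thesis using real by (simp add: lp_norm_def)
next
  case PInf
  have "continuous_on A (\<lambda>x. Max (insert 0 ((\<lambda>j. \<bar>f x j\<bar>) ` S)))"
    using finite[of S]
  proof induction
    case (insert a S)
    have "Max (insert 0 ((\<lambda>j. \<bar>f x j\<bar>) ` insert a S))
        = max \<bar>f x a\<bar> (Max (insert 0 ((\<lambda>j. \<bar>f x j\<bar>) ` S)))" for x
      by (simp add: insert_commute[of 0] del: Max_insert) (subst Max_insert, auto)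
    then show ?case using insert.IH by (simp only:) (intro continuous_on_max continuous_on_rabs f)
  qed auto
  then show ?thesis using PInf by (simp add: lp_norm_def)
qed (use assms(1) in simp)

lemma Omega_attained:
  fixes G :: "'b::finite \<Rightarrow> 'd::finite set"
  assumes "1 \<le> p" and cover: "(\<Union>r. G r) = UNIV"
  shows "\<exists>v\<in>decompositions G x.
      Omega p G x = (\<Sum>r\<in>UNIV. lp_norm p (G r) (v r)) \<and>
      (\<forall>u\<in>decompositions G x. Omega p G x \<le> (\<Sum>r\<in>UNIV. lp_norm p (G r) (u r)))"
proof -
  define F :: "real^'d^'b \<Rightarrow> real" where "F w = (\<Sum>r\<in>UNIV. lp_norm p (G r) (($) (w $ r)))" for w
  define A :: "(real^'d^'b) set"
    where "A = {w. (\<forall>r j. j \<notin> G r \<longrightarrow> w $ r $ j = 0) \<and> (\<Sum>r\<in>UNIV. w $ r) = x}"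
  have contF: "continuous_on S F" for S
    unfolding F_def by (intro continuous_on_sum continuous_on_lp_norm assms continuous_intros)
  have clA: "closed A"
  proof -
    have A_eq: "A = (\<Inter>r. \<Inter>j\<in>- G r. {w. w $ r $ j = 0}) \<inter> {w. (\<Sum>r\<in>UNIV. w $ r) = x}"
      unfolding A_def by auto
    show ?thesis unfolding A_eq
      by (intro closed_Int closed_INT ballI closed_Collect_eq continuous_intros)
  qed
  obtain c where c: "\<And>j. j \<in> G (c j)" using cover by (metis UNIV_I UN_E)
  define w0 :: "real^'d^'b" where "w0 = (\<chi> r j. if r = c j then x $ j else 0)"
  have w0: "w0 \<in> A"
    unfolding A_def w0_def using c by (auto simp: vec_eq_iff)
  define A' where "A' = A \<inter> {w. F w \<le> F w0}"
  have bnd: "norm w \<le> (\<Sum>r\<in>(UNIV::'b set). \<Sum>j\<in>(UNIV::'d set). F w0)" if "w \<in> A'" for w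
  proof -
    have le: "\<bar>w $ r $ j\<bar> \<le> F w0" for r j
    proof -
      have "\<bar>w $ r $ j\<bar> \<le> lp_norm p (G r) (($) (w $ r))"
        using that abs_le_lp_norm[OF assms(1), of j "G r" "($) (w $ r)"] lp_norm_nonneg[of p "G r"]
        by (cases "j \<in> G r") (auto simp: A'_def A_def)
      also have "\<dots> \<le> F w" unfolding F_def
        by (rule member_le_sum[of r UNIV "\<lambda>r. lp_norm p (G r) (($) (w $ r))"])
          (auto simp: lp_norm_nonneg)
      also have "\<dots> \<le> F w0" using that by (auto simp: A'_def)
      finally show ?thesis .
    qed
    have "norm w \<le> (\<Sum>r\<in>UNIV. norm (w $ r))"
      unfolding norm_vec_def[of w] by (rule L2_set_le_sum) simp
    also have "\<dots> \<le> (\<Sum>r\<in>UNIV. \<Sum>j\<in>UNIV. \<bar>w $ r $ j\<bar>)"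
      by (intro sum_mono norm_le_l1_cart)
    also have "\<dots> \<le> (\<Sum>r\<in>(UNIV::'b set). \<Sum>j\<in>(UNIV::'d set). F w0)"
      by (intro sum_mono le)
    finally show ?thesis .
  qed
  have "closed A'" unfolding A'_def
    by (intro closed_Int clA closed_Collect_le contF continuous_intros)
  moreover have "bounded A'" using bnd by (rule boundedI)
  ultimately have "compact A'" by (simp add: compact_eq_bounded_closed)
  moreover have "A' \<noteq> {}" using w0 by (auto simp: A'_def)
  ultimately obtain w where w: "w \<in> A'" and wmin: "\<And>u. u \<in> A' \<Longrightarrow> F w \<le> F u"
    using continuous_attains_inf[of A' F] contF[of A'] by metis
  have wmin: "F w \<le> F u" if "u \<in> A" for u
    using wmin[of u] w that by (cases "F u \<le> F w0") (auto simp: A'_def)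
  define v where "v r = restrict (($) (w $ r)) (G r)" for r
  have Fv: "(\<Sum>r\<in>UNIV. lp_norm p (G r) (v r)) = F w"
    unfolding F_def v_def by (intro sum.cong lp_norm_cong) auto
  have ze: "zero_ext (G r) (v r) = w $ r" for r
    using w by (auto simp: zero_ext_def v_def vec_eq_iff A'_def A_def)
  then have v: "v \<in> decompositions G x"
    using w by (auto simp: decompositions_def P_star_def v_def A'_def A_def)
  have low: "(\<Sum>r\<in>UNIV. lp_norm p (G r) (v r)) \<le> (\<Sum>r\<in>UNIV. lp_norm p (G r) (u r))"
    if "u \<in> decompositions G x" for u
  proof -
    define u' :: "real^'d^'b" where "u' = (\<chi> r. zero_ext (G r) (u r))"
    have "u' \<in> A" using that
      by (auto simp: u'_def A_def decompositions_def P_star_def zero_ext_def)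
    moreover have "F u' = (\<Sum>r\<in>UNIV. lp_norm p (G r) (u r))"
      unfolding F_def u'_def by (intro sum.cong lp_norm_cong) (auto simp: zero_ext_def)
    ultimately show ?thesis using wmin[of u'] Fv by simp
  qed
  have "Omega p G x = (\<Sum>r\<in>UNIV. lp_norm p (G r) (v r))"
    unfolding Omega_def using v low by (intro cInf_eq_minimum) auto
  then show ?thesis using v low by auto
qed

end

theory Submission
  imports Defs
begin

text \<open>
  The penalty \<open>Omega p G\<close> is an infimal convolution of \<open>\<ell>\<^sup>p\<close> norms on the groups, hence a seminorm,
  and by Hoelder duality its dual ball is exactly \<open>K_set q G\<close> (\<open>K_set_eq_dual_ball\<close>). Consequently
  subtracting the projection onto a multiple of \<open>K_set q G\<close> is an exact proximal step
  (Moreau's identity, \<open>dual_projection_is_prox\<close>), and both algorithms are proximal gradient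
  methods whose iterates differ from an exact proximal gradient point by at most \<open>\<epsilon> m\<close>.

  With exact steps, the classical analysis shows that a potential
  \<open>t\<^sup>2 * (E x - E xs) + L / 2 * (norm (xs - u))\<^sup>2\<close>
  does not increase; here \<open>t = 1\<close>, \<open>u = x\<close> for ISTA, with the energy gaps of all earlier iterates added, and
  \<open>t = s m\<close>, \<open>u = s m *\<^sub>R x m - (s m - 1) *\<^sub>R x (m - 1)\<close> for FISTA. An error of size \<open>\<epsilon>\<close> in the
  iterate increases this potential by at most the factor \<open>1 + C * \<eta>\<close> and the summand \<open>C * \<eta>\<close>,
  for a constant \<open>C\<close> and \<open>\<eta> = t\<^sup>2 * \<epsilon>\<close> (\<open>potential_perturbed\<close>). The energy is not globally Lipschitz;
  what makes the estimate work with one constant for all iterates is that the gradient of a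
  nonnegative smooth function is controlled by the function itself (\<open>gradient_bound\<close>), so that the
  damage is proportional to the potential. Since \<open>s m\<close> lies between \<open>(m + 1) / 2\<close> and \<open>m\<close>, the
  numbers \<open>\<eta>\<close> are of order \<open>m powr (- \<alpha>)\<close> for ISTA and \<open>m powr (2 - \<alpha>)\<close> for FISTA. Their sums are
  finite, so a discrete Gronwall inequality (\<open>discrete_Gronwall\<close>) keeps the potential bounded.
  Boundedness gives the rates: by convexity of the energy for the averages in ISTA, and by division
  by \<open>(s m)\<^sup>2\<close> in FISTA.

  The resulting constants involve a minimizer. As all minimizers have the same energy, one of them
  is fixed before the iterates are given.
\<close>

section \<open>Conjugate exponents\<close>

text \<open>
  The bounds rule out degenerate solutions such as \<open>p = - \<infinity>\<close>, \<open>q = 1\<close>, as \<open>1 / (- \<infinity>) = 0\<close>.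
\<close>

definition conjugate_exponents :: "ereal \<Rightarrow> ereal \<Rightarrow> bool" where
  "conjugate_exponents p q \<longleftrightarrow> 1 \<le> p \<and> 1 \<le> q \<and> 1 / p + 1 / q = 1"

lemma conjugate_exponents_sym: "conjugate_exponents p q \<Longrightarrow> conjugate_exponents q p"
  by (auto simp: conjugate_exponents_def add.commute)

lemma conjugate_exponentsI:
  assumes "1 < p" "1 / p + 1 / q = 1"
  shows "conjugate_exponents p q"
proof (cases p)
  case (real t)
  then have t: "t > 1" using assms by simp
  show ?thesis
  proof (cases q)
    case (real s)
    show ?thesis
    proof (cases "s = 0")
      case False
      then have "1 / t + 1 / s = 1"
        using assms(2) t \<open>p = ereal t\<close> real by (simp add: one_ereal_def)
      moreover have "0 < 1 / t" "1 / t < 1" using t by simp_all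
      ultimately have "0 < 1 / s" "1 / s < 1" by linarith+
      then have "1 < s" by (simp add: zero_less_divide_iff divide_less_eq_1)
      then show ?thesis using assms real by (simp add: conjugate_exponents_def)
    next
      case True
      then show ?thesis using assms(2) t \<open>p = ereal t\<close> real
        by (simp add: one_ereal_def zero_ereal_def[symmetric] divide_ereal_def)
    qed
  qed (use assms t \<open>p = ereal t\<close> in \<open>auto simp: one_ereal_def\<close>)
next
  case PInf
  then have *: "1 / q = 1" using assms(2) by simp
  have "q = 1"
  proof (cases q)
    case (real s)
    then show ?thesis using * by (cases "s = 0") (auto simp: one_ereal_def divide_ereal_def)
  qed (use * in auto)
  then show ?thesis using PInf by (simp add: conjugate_exponents_def)
qed (use assms in simp)

lemma conjugate_exponents_cases:
  assumes "conjugate_exponents p q"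
  obtains (finite) t s where "p = ereal t" "q = ereal s" "1 < t" "1 < s" "1 / t + 1 / s = 1"
    | (one_inf) "p = 1" "q = \<infinity>"
    | (inf_one) "p = \<infinity>" "q = 1"
proof -
  have *: "1 \<le> p" "1 \<le> q" "1 / p + 1 / q = 1" using assms by (auto simp: conjugate_exponents_def)
  show thesis
  proof (cases p)
    case p: (real t)
    show ?thesis
    proof (cases q)
      case q: (real s)
      have ts: "t \<ge> 1" "s \<ge> 1" "1 / t + 1 / s = 1"
        using * p q by (auto simp: one_ereal_def)
      then have "0 < 1 / t" "0 < 1 / s" by simp_all
      then have "1 / t < 1" "1 / s < 1" using ts(3) by linarith+
      then have "t \<noteq> 1" "s \<noteq> 1" by auto
      then show ?thesis using finite[of t s] p q ts by simp
    next
      case PInf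
      then have "1 / t = 1" using * p by (auto simp: one_ereal_def)
      then have "t = 1" by simp
      then show ?thesis using one_inf p PInf by (simp add: one_ereal_def)
    qed (use * in simp)
  next
    case PInf
    then have "1 / q = 1" using * by simp
    then have "q = 1"
      using * by (cases q) (auto simp: one_ereal_def)
    then show ?thesis using inf_one PInf by simp
  qed (use * in simp)
qed

section \<open>Duality of the \<open>\<ell>\<^sup>p\<close> norms\<close>

lemma lp_norm_infinity: "lp_norm \<infinity> S f = Max (insert 0 ((\<lambda>j. \<bar>f j\<bar>) ` S))"
  by (simp add: lp_norm_def)

lemma lp_norm_real:
  "lp_norm (ereal t) S f = (\<Sum>j\<in>S. \<bar>f j\<bar> powr t) powr (1 / t)"
  by (simp add: lp_norm_def)

lemma lp_norm_one: "lp_norm 1 S f = (\<Sum>j\<in>S. \<bar>f j\<bar>)"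
  by (simp add: lp_norm_def sum_nonneg)

lemma lp_norm_zero: "1 \<le> p \<Longrightarrow> lp_norm p S (\<lambda>_. 0) = 0"
proof (cases p)
  case PInf
  then show ?thesis by (auto simp: lp_norm_infinity intro!: Max_eqI)
qed (simp_all add: lp_norm_real)

lemma lp_norm_cmult_le:
  assumes "1 \<le> p"
  shows "lp_norm p S (\<lambda>j. c * f j) \<le> \<bar>c\<bar> * lp_norm p S f"
proof (cases p)
  case (real t)
  then have "t \<ge> 1" using assms by simp
  then have "lp_norm p S (\<lambda>j. c * f j) = (\<bar>c\<bar> powr t * (\<Sum>j\<in>S. \<bar>f j\<bar> powr t)) powr (1 / t)"
    by (simp add: real lp_norm_real abs_mult powr_mult sum_distrib_left)
  also have "\<dots> = \<bar>c\<bar> * lp_norm p S f"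
    using \<open>t \<ge> 1\<close> by (simp add: real lp_norm_real powr_mult sum_nonneg powr_powr)
  finally show ?thesis by simp
next
  case PInf
  have "\<bar>c * f j\<bar> \<le> \<bar>c\<bar> * lp_norm p S f" if "j \<in> S" for j
    unfolding abs_mult using that by (intro mult_left_mono abs_le_lp_norm assms) auto
  then show ?thesis
    using lp_norm_nonneg[of p S f] by (auto simp: PInf lp_norm_infinity)
qed (use assms in simp)

text \<open>
  If neither norm vanishes, Young's inequality for the normalized entries sums up to
  \<open>1 / t + 1 / s = 1\<close>; the exponents \<open>1\<close> and \<open>\<infinity>\<close> are elementary.
\<close>

lemma lp_norm_Holder:
  assumes "conjugate_exponents p q"
  shows "(\<Sum>j\<in>S. f j * g j) \<le> lp_norm p S f * lp_norm q S g"
  using assms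
proof (cases rule: conjugate_exponents_cases)
  case (finite t s)
  define a where "a = lp_norm p S f"
  define b where "b = lp_norm q S g"
  have ge1: "1 \<le> p" "1 \<le> q" using assms by (auto simp: conjugate_exponents_def)
  show ?thesis
  proof (cases "a = 0 \<or> b = 0")
    case True
    then have "f j * g j = 0" if "j \<in> S" for j
      using abs_le_lp_norm[OF ge1(1) that, of f] abs_le_lp_norm[OF ge1(2) that, of g]
      by (auto simp: a_def b_def)
    then have "(\<Sum>j\<in>S. f j * g j) = 0" by (rule sum.neutral[OF ballI])
    then show ?thesis by (simp add: lp_norm_nonneg)
  next
    case False
    then have pos: "a > 0" "b > 0"
      using lp_norm_nonneg[of p S f] lp_norm_nonneg[of q S g] by (auto simp: a_def b_def)
    have unit: "(\<Sum>j\<in>S. (\<bar>h j\<bar> / c) powr u) = 1"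
      if "u > 1" "c = lp_norm (ereal u) S h" "c > 0" for h c u
    proof -
      have "c powr u = (\<Sum>j\<in>S. \<bar>h j\<bar> powr u)"
        using that(1) by (simp add: that(2) lp_norm_real powr_powr sum_nonneg)
      moreover have "c powr u > 0" using that by simp
      ultimately show ?thesis
        using that by (simp add: powr_divide sum_divide_distrib[symmetric])
    qed
    have "(\<Sum>j\<in>S. f j * g j) / (a * b) \<le> (\<Sum>j\<in>S. (\<bar>f j\<bar> / a) * (\<bar>g j\<bar> / b))"
      unfolding sum_divide_distrib
      using pos by (intro sum_mono) (auto simp: divide_simps abs_mult[symmetric])
    also have "\<dots> \<le> (\<Sum>j\<in>S. (\<bar>f j\<bar> / a) powr t / t + (\<bar>g j\<bar> / b) powr s / s)"
      using finite pos by (intro sum_mono Youngs_inequality) auto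
    also have "\<dots> = 1 / t + 1 / s"
      using unit[of t a f] unit[of s b g] finite pos
      by (simp add: sum.distrib sum_divide_distrib[symmetric] a_def b_def)
    finally show ?thesis
      using finite pos by (simp add: a_def b_def pos_divide_le_eq)
  qed
next
  case one_inf
  have "f j * g j \<le> \<bar>f j\<bar> * lp_norm q S g" if "j \<in> S" for j
  proof -
    have "f j * g j \<le> \<bar>f j\<bar> * \<bar>g j\<bar>" by (simp add: abs_mult[symmetric])
    also have "\<dots> \<le> \<bar>f j\<bar> * lp_norm q S g"
      using that one_inf by (intro mult_left_mono abs_le_lp_norm) auto
    finally show ?thesis .
  qed
  then show ?thesis unfolding one_inf(1) lp_norm_one sum_distrib_right by (rule sum_mono)
next
  case inf_one
  have "f j * g j \<le> lp_norm p S f * \<bar>g j\<bar>" if "j \<in> S" for j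
  proof -
    have "f j * g j \<le> \<bar>f j\<bar> * \<bar>g j\<bar>" by (simp add: abs_mult[symmetric])
    also have "\<dots> \<le> lp_norm p S f * \<bar>g j\<bar>"
      using that inf_one by (intro mult_right_mono abs_le_lp_norm) auto
    finally show ?thesis .
  qed
  then show ?thesis unfolding inf_one(2) lp_norm_one sum_distrib_left by (rule sum_mono)
qed

text \<open>
  Equality in Hoelder's inequality: the extremal function is the normalized
  \<open>sgn (f j) * \<bar>f j\<bar> powr (t - 1)\<close> for a finite exponent \<open>t > 1\<close>, the sign of \<open>f\<close> for exponent \<open>1\<close>,
  and the sign of \<open>f\<close> at one index of largest modulus for exponent \<open>\<infinity>\<close>.
\<close>

lemma lp_norm_dual_attained:
  assumes "conjugate_exponents p q"
  shows "\<exists>g. lp_norm q S g \<le> 1 \<and> (\<Sum>j\<in>S. f j * g j) = lp_norm p S f"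
  using assms
proof (cases rule: conjugate_exponents_cases)
  case (finite t s)
  define A where "A = (\<Sum>j\<in>S. \<bar>f j\<bar> powr t)"
  have A0: "A \<ge> 0" by (simp add: A_def sum_nonneg)
  show ?thesis
  proof (cases "A = 0")
    case True
    then have "lp_norm p S f = 0" by (simp add: finite lp_norm_real A_def)
    moreover have "1 \<le> q" using assms by (simp add: conjugate_exponents_def)
    ultimately show ?thesis by (intro exI[of _ "\<lambda>_. 0"]) (simp add: lp_norm_zero)
  next
    case False
    then have A: "A > 0" using A0 by simp
    have ts: "t + s = t * s" using finite by (simp add: field_simps)
    have ts1: "(t - 1) * s = t" using ts by (simp add: algebra_simps)
    define g where "g j = sgn (f j) * \<bar>f j\<bar> powr (t - 1) / A powr (1 / s)" for j
    have "\<bar>g j\<bar> powr s = \<bar>f j\<bar> powr t / A" for j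
    proof (cases "f j = 0")
      case False
      then have "\<bar>g j\<bar> = \<bar>f j\<bar> powr (t - 1) / A powr (1 / s)"
        by (simp add: g_def abs_mult abs_sgn_eq)
      then show ?thesis using A finite by (simp add: powr_divide powr_powr ts1)
    qed (use finite in \<open>simp add: g_def\<close>)
    then have "(\<Sum>j\<in>S. \<bar>g j\<bar> powr s) = 1"
      using A by (simp add: sum_divide_distrib[symmetric] A_def[symmetric])
    then have 1: "lp_norm q S g \<le> 1" by (simp add: finite lp_norm_real)
    have "f j * g j = \<bar>f j\<bar> powr t / A powr (1 / s)" for j
    proof (cases "f j = 0")
      case False
      have "f j * g j = \<bar>f j\<bar> * \<bar>f j\<bar> powr (t - 1) / A powr (1 / s)"
        by (simp add: g_def abs_sgn mult.assoc)
      also have "\<bar>f j\<bar> * \<bar>f j\<bar> powr (t - 1) = \<bar>f j\<bar> powr t"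
        using False by (simp add: powr_mult_base)
      finally show ?thesis .
    qed (use finite in simp)
    then have "(\<Sum>j\<in>S. f j * g j) = A / A powr (1 / s)"
      by (simp add: sum_divide_distrib[symmetric] A_def[symmetric])
    also have "\<dots> = A powr (1 - 1 / s)" using A by (simp add: powr_diff)
    also have "1 - 1 / s = 1 / t" using finite by simp
    finally show ?thesis using 1 by (auto simp: finite lp_norm_real A_def)
  qed
next
  case one_inf
  have "lp_norm q S (\<lambda>j. sgn (f j)) \<le> 1"
    by (auto simp: one_inf lp_norm_infinity abs_sgn_eq)
  moreover have "(\<Sum>j\<in>S. f j * sgn (f j)) = lp_norm p S f"
    by (simp add: one_inf lp_norm_one abs_sgn)
  ultimately show ?thesis by blast
next
  case inf_one
  have "lp_norm p S f \<in> insert 0 ((\<lambda>j. \<bar>f j\<bar>) ` S)"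
    unfolding inf_one(1) lp_norm_infinity by (rule Max_in) auto
  then consider "lp_norm p S f = 0" | k where "k \<in> S" "lp_norm p S f = \<bar>f k\<bar>" by auto
  then show ?thesis
  proof cases
    case 1
    then show ?thesis by (intro exI[of _ "\<lambda>_. 0"]) (simp add: inf_one lp_norm_zero)
  next
    case 2
    define g where "g j = (if j = k then sgn (f k) else 0)" for j
    have "\<bar>g j\<bar> = (if j = k then \<bar>sgn (f k)\<bar> else 0)" for j by (simp add: g_def)
    then have "lp_norm q S g \<le> 1" using 2 by (simp add: inf_one lp_norm_one abs_sgn_eq)
    moreover have "f j * g j = (if j = k then \<bar>f k\<bar> else 0)" for j
      by (simp add: g_def abs_sgn)
    ultimately show ?thesis using 2 by auto
  qed
qed

text \<open>
  A norm that is a maximum of linear functionals is subadditive.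
\<close>

lemma lp_norm_triangle:
  assumes "conjugate_exponents p q"
  shows "lp_norm p S (\<lambda>j. f j + g j) \<le> lp_norm p S f + lp_norm p S g"
proof -
  obtain h where h: "lp_norm q S h \<le> 1" "(\<Sum>j\<in>S. (f j + g j) * h j) = lp_norm p S (\<lambda>j. f j + g j)"
    using lp_norm_dual_attained[OF assms, of S "\<lambda>j. f j + g j"] by blast
  have bound: "(\<Sum>j\<in>S. k j * h j) \<le> lp_norm p S k" for k
    using lp_norm_Holder[OF assms, of k h S] mult_left_mono[OF h(1) lp_norm_nonneg[of p S k]]
    by simp
  have "(\<Sum>j\<in>S. (f j + g j) * h j) = (\<Sum>j\<in>S. f j * h j) + (\<Sum>j\<in>S. g j * h j)"
    by (simp add: distrib_right sum.distrib)
  then show ?thesis using h(2) bound[of f] bound[of g] by simp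
qed

section \<open>Seminorms as support functions\<close>

text \<open>
  Absolute homogeneity follows from the inequality \<open>scale_le\<close>, applied to \<open>c\<close> and to \<open>inverse c\<close>.
\<close>

locale seminorm =
  fixes N :: "'a::euclidean_space \<Rightarrow> real"
  assumes triangle: "N (x + y) \<le> N x + N y"
    and scale_le: "N (c *\<^sub>R x) \<le> \<bar>c\<bar> * N x"
begin

lemma zero [simp]: "N 0 = 0"
proof -
  have "N 0 \<le> 0" using scale_le[of 0 0] by simp
  moreover have "N 0 \<le> N 0 + N 0" using triangle[of 0 0] by simp
  ultimately show ?thesis by simp
qed

lemma nonneg: "0 \<le> N x"
proof -
  have "N (x + (-1) *\<^sub>R x) \<le> N x + \<bar>-1\<bar> * N x"
    by (rule order_trans[OF triangle add_left_mono[OF scale_le]])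
  then show ?thesis by simp
qed

lemma convex_on: "convex_on UNIV N"
proof (intro convex_onI)
  fix t x y assume "0 < t" "(t::real) < 1"
  then show "N ((1 - t) *\<^sub>R x + t *\<^sub>R y) \<le> (1 - t) * N x + t * N y"
    using triangle[of "(1 - t) *\<^sub>R x" "t *\<^sub>R y"] scale_le[of "1 - t" x] scale_le[of t y] by simp
qed simp

definition lipschitz_const :: real where
  "lipschitz_const = (\<Sum>b\<in>Basis. N b)"

lemma lipschitz_const_nonneg: "0 \<le> lipschitz_const"
  by (simp add: lipschitz_const_def sum_nonneg nonneg)

lemma le_norm: "N x \<le> lipschitz_const * norm x"
proof -
  have sum_le: "N (\<Sum>b\<in>A. (x \<bullet> b) *\<^sub>R b) \<le> (\<Sum>b\<in>A. \<bar>x \<bullet> b\<bar> * N b)" if "finite A" for A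
    using that
  proof induction
    case (insert a A)
    then show ?case
      using triangle[of "(x \<bullet> a) *\<^sub>R a" "\<Sum>b\<in>A. (x \<bullet> b) *\<^sub>R b"] scale_le[of "x \<bullet> a" a] by simp
  qed simp
  have "N x = N (\<Sum>b\<in>Basis. (x \<bullet> b) *\<^sub>R b)" by (simp add: euclidean_representation)
  also have "\<dots> \<le> (\<Sum>b\<in>Basis. \<bar>x \<bullet> b\<bar> * N b)" by (rule sum_le) simp
  also have "\<dots> \<le> (\<Sum>b\<in>Basis. norm x * N b)"
    by (intro sum_mono mult_right_mono nonneg Basis_le_norm)
  finally show ?thesis by (simp add: lipschitz_const_def sum_distrib_left mult.commute)
qed

lemma lipschitz: "\<bar>N x - N y\<bar> \<le> lipschitz_const * norm (x - y)"
  using triangle[of "x - y" y] triangle[of "y - x" x] le_norm[of "x - y"] le_norm[of "y - x"]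
  by (simp add: norm_minus_commute)

lemma continuous: "continuous_on A N"
proof (rule continuous_on_subset[OF _ subset_UNIV])
  have "lipschitz_const-lipschitz_on UNIV N"
    using lipschitz by (intro lipschitz_onI) (auto simp: dist_real_def dist_norm lipschitz_const_nonneg)
  then show "continuous_on UNIV N" by (rule lipschitz_on_continuous_on)
qed

definition dual_ball :: "'a set" where
  "dual_ball = {u. \<forall>v. u \<bullet> v \<le> N v}"

lemma dual_ball_convex: "convex dual_ball"
proof -
  have "dual_ball = (\<Inter>v. {u. v \<bullet> u \<le> N v})"
    by (auto simp: dual_ball_def inner_commute)
  then show ?thesis by (simp add: convex_INT convex_halfspace_le)
qed

lemma dual_ball_closed: "closed dual_ball"
proof -
  have "dual_ball = (\<Inter>v. {u. v \<bullet> u \<le> N v})"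
    by (auto simp: dual_ball_def inner_commute)
  then show ?thesis by (simp add: closed_INT closed_halfspace_le)
qed

lemma zero_in_dual_ball: "0 \<in> dual_ball"
  by (simp add: dual_ball_def nonneg)

text \<open>
  A closed sublevel set \<open>{v. N v \<le> c}\<close> that misses \<open>x\<close> is separated from \<open>x\<close> by a hyperplane;
  scaled so that the hyperplane lies at height \<open>c\<close>, its normal belongs to the dual ball by
  homogeneity of \<open>N\<close>. Hence \<open>N\<close> is the support function of its dual ball.
\<close>

lemma dual_ball_norming:
  assumes "0 < c" "c < N x"
  shows "\<exists>u\<in>dual_ball. c < u \<bullet> x"
proof -
  define B where "B = {v. N v \<le> c}"
  have "convex B"
  proof (rule convexI)
    fix v w s t assume "v \<in> B" "w \<in> B" and st: "0 \<le> s" "0 \<le> t" "s + t = (1::real)"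
    then have "s * N v + t * N w \<le> c"
      by (intro convex_bound_le) (auto simp: B_def)
    then show "s *\<^sub>R v + t *\<^sub>R w \<in> B"
      using triangle[of "s *\<^sub>R v" "t *\<^sub>R w"] scale_le[of s v] scale_le[of t w] st
      by (simp add: B_def)
  qed
  moreover have "closed B"
    unfolding B_def by (intro closed_Collect_le continuous continuous_on_const)
  moreover have "x \<notin> B" using assms by (simp add: B_def)
  ultimately obtain a b where ab: "a \<bullet> x < b" "\<And>v. N v \<le> c \<Longrightarrow> b < a \<bullet> v"
    using separating_hyperplane_closed_point[of B x] by (auto simp: B_def)
  have b: "b < 0" using ab(2)[of 0] assms by simp
  define u where "u = (c / b) *\<^sub>R a"
  have "u \<bullet> v \<le> N v" for v
  proof (rule field_le_epsilon)
    \<comment> \<open>The slack \<open>e\<close> allows \<open>v\<close> to be rescaled to the boundary of the sublevel set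
      even where \<open>N v = 0\<close>.\<close>
    fix e :: real assume e: "0 < e"
    define r where "r = c / (N v + e)"
    have r: "r > 0" using assms e nonneg[of v] by (simp add: r_def add_nonneg_pos)
    have "N (r *\<^sub>R v) \<le> r * N v" using scale_le[of r v] r by simp
    also have "\<dots> \<le> r * (N v + e)" using r e by (intro mult_left_mono) auto
    also have "\<dots> = c" using e nonneg[of v] by (simp add: r_def)
    finally have "b < r * (a \<bullet> v)" using ab(2)[of "r *\<^sub>R v"] by simp
    then have "r * (a \<bullet> v) / b \<le> 1" using b by (simp add: divide_le_eq_1)
    then have "c * (r * (a \<bullet> v) / b) \<le> c * 1" using assms by (intro mult_left_mono) auto
    then have "r * (u \<bullet> v) \<le> r * (N v + e)"
      using e nonneg[of v] by (simp add: u_def r_def mult_ac)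
    then show "u \<bullet> v \<le> N v + e" using r by (simp add: mult_le_cancel_left)
  qed
  moreover have "c < u \<bullet> x"
  proof -
    have "1 < (a \<bullet> x) / b" using ab(1) b by (simp add: less_divide_eq)
    then have "c * 1 < c * ((a \<bullet> x) / b)" using assms by (intro mult_strict_left_mono) auto
    then show ?thesis by (simp add: u_def)
  qed
  ultimately show ?thesis by (auto simp: dual_ball_def)
qed

text \<open>
  Moreau's identity: \<open>z\<close> is the proximal point of \<open>t * N\<close> at \<open>w\<close>, expressed by its variational
  inequality. The projection \<open>w - z\<close> equals \<open>t *\<^sub>R u\<close> for some \<open>u\<close> in the dual ball, and the obtuse-angle
  property of projections says that \<open>u\<close> maximizes the inner product with \<open>z\<close> over the dual ball.
  The maximum is \<open>N z\<close>, so \<open>u\<close> is a subgradient of \<open>N\<close> at \<open>z\<close>.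
\<close>

lemma dual_projection_is_prox:
  fixes w v :: 'a and t :: real
  assumes t: "0 < t"
  defines "z \<equiv> w - closest_point ((*\<^sub>R) t ` dual_ball) w"
  shows "t * N z + (w - z) \<bullet> (v - z) \<le> t * N v"
proof -
  let ?C = "(*\<^sub>R) t ` dual_ball"
  have C: "convex ?C" "closed ?C" "?C \<noteq> {}"
    using zero_in_dual_ball
    by (auto intro: convex_scaling dual_ball_convex closed_scaling dual_ball_closed)
  have "w - z \<in> ?C" using closest_point_in_set[OF C(2,3), of w] by (simp add: z_def)
  then obtain u where u: "u \<in> dual_ball" "w - z = t *\<^sub>R u" by auto
  have max: "k \<bullet> z \<le> u \<bullet> z" if "k \<in> dual_ball" for k
  proof -
    have "(w - closest_point ?C w) \<bullet> (t *\<^sub>R k - closest_point ?C w) \<le> 0"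
      using that by (intro closest_point_dot C) auto
    moreover have "closest_point ?C w = t *\<^sub>R u" using u(2) by (simp add: z_def)
    ultimately have "z \<bullet> (t *\<^sub>R k - t *\<^sub>R u) \<le> 0" by (simp add: z_def)
    then have "t * (k \<bullet> z - u \<bullet> z) \<le> 0"
      by (simp add: inner_diff_right inner_commute algebra_simps)
    then show ?thesis using t by (simp add: mult_le_0_iff)
  qed
  have "N z \<le> u \<bullet> z"
  proof (rule ccontr)
    assume "\<not> N z \<le> u \<bullet> z"
    moreover have "0 \<le> u \<bullet> z" using max[OF zero_in_dual_ball] by simp
    ultimately obtain c where c: "u \<bullet> z < c" "c < N z" "0 < c"
      using dense[of "u \<bullet> z" "N z"] by auto
    then show False using dual_ball_norming[of c z] max by fastforce
  qed
  moreover have "u \<bullet> v \<le> N v" using u(1) by (simp add: dual_ball_def)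
  ultimately have "t * (N z + (u \<bullet> v - u \<bullet> z)) \<le> t * N v"
    using t by (intro mult_left_mono) auto
  then show ?thesis by (simp add: u(2) inner_diff_right algebra_simps)
qed

end

section \<open>The group penalty\<close>

context
  fixes p q :: ereal and G :: "'b::finite \<Rightarrow> 'd::finite set"
  assumes conj: "conjugate_exponents p q" and cover: "(\<Union>r. G r) = UNIV"
begin

lemma p_ge_1: "1 \<le> p"
  using conj by (simp add: conjugate_exponents_def)

lemma Omega_le:
  assumes "P_star G v = x"
  shows "Omega p G x \<le> (\<Sum>r\<in>UNIV. lp_norm p (G r) (v r))"
proof -
  define v' where "v' r = restrict (v r) (G r)" for r
  have "zero_ext (G r) (v' r) = zero_ext (G r) (v r)" for r
    by (auto simp: zero_ext_def v'_def vec_eq_iff)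
  then have "v' \<in> decompositions G x"
    using assms by (auto simp: decompositions_def P_star_def v'_def)
  then have "Omega p G x \<le> (\<Sum>r\<in>UNIV. lp_norm p (G r) (v' r))"
    using Omega_attained[OF p_ge_1 cover] by blast
  also have "\<dots> = (\<Sum>r\<in>UNIV. lp_norm p (G r) (v r))"
    by (intro sum.cong lp_norm_cong) (auto simp: v'_def)
  finally show ?thesis .
qed

lemma Omega_decomposition:
  obtains v where "P_star G v = x" "Omega p G x = (\<Sum>r\<in>UNIV. lp_norm p (G r) (v r))"
  using Omega_attained[OF p_ge_1 cover, of x] by (auto simp: decompositions_def)

lemma seminorm_Omega: "seminorm (Omega p G)"
proof
  fix x y :: "real^'d" and c :: real
  obtain v where v: "P_star G v = x" "Omega p G x = (\<Sum>r\<in>UNIV. lp_norm p (G r) (v r))"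
    by (rule Omega_decomposition)
  obtain w where w: "P_star G w = y" "Omega p G y = (\<Sum>r\<in>UNIV. lp_norm p (G r) (w r))"
    by (rule Omega_decomposition)
  have "P_star G (\<lambda>r j. v r j + w r j) = x + y"
    unfolding v(1)[symmetric] w(1)[symmetric] P_star_def sum.distrib[symmetric]
    by (intro sum.cong) (auto simp: zero_ext_def vec_eq_iff)
  then have "Omega p G (x + y) \<le> (\<Sum>r\<in>UNIV. lp_norm p (G r) (\<lambda>j. v r j + w r j))"
    by (rule Omega_le)
  also have "\<dots> \<le> (\<Sum>r\<in>UNIV. lp_norm p (G r) (v r) + lp_norm p (G r) (w r))"
    by (intro sum_mono lp_norm_triangle[OF conj])
  finally show "Omega p G (x + y) \<le> Omega p G x + Omega p G y"
    by (simp add: v(2) w(2) sum.distrib)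
  have "P_star G (\<lambda>r j. c * v r j) = c *\<^sub>R x"
    unfolding v(1)[symmetric] P_star_def scaleR_sum_right
    by (intro sum.cong) (auto simp: zero_ext_def vec_eq_iff)
  then have "Omega p G (c *\<^sub>R x) \<le> (\<Sum>r\<in>UNIV. lp_norm p (G r) (\<lambda>j. c * v r j))"
    by (rule Omega_le)
  also have "\<dots> \<le> (\<Sum>r\<in>UNIV. \<bar>c\<bar> * lp_norm p (G r) (v r))"
    by (intro sum_mono lp_norm_cmult_le p_ge_1)
  finally show "Omega p G (c *\<^sub>R x) \<le> \<bar>c\<bar> * Omega p G x"
    by (simp add: v(2) sum_distrib_left)
qed

text \<open>
  Vectors supported in one group compete with their trivial decomposition. Testing with them
  recovers the constraint of each group in \<open>K_set_eq_dual_ball\<close>.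
\<close>

lemma Omega_single_group: "Omega p G (zero_ext (G r) f) \<le> lp_norm p (G r) f"
proof -
  define v where "v i = (if i = r then f else (\<lambda>_. 0))" for i
  have "zero_ext (G i) (v i) = (if i = r then zero_ext (G r) f else 0)" for i
    by (auto simp: v_def zero_ext_def vec_eq_iff)
  then have "P_star G v = zero_ext (G r) f" by (simp add: P_star_def)
  then have "Omega p G (zero_ext (G r) f) \<le> (\<Sum>i\<in>UNIV. lp_norm p (G i) (v i))"
    by (rule Omega_le)
  also have "\<dots> = (\<Sum>i\<in>UNIV. if i = r then lp_norm p (G r) f else 0)"
    by (intro sum.cong) (auto simp: v_def lp_norm_zero p_ge_1)
  finally show ?thesis by simp
qed

lemma inner_zero_ext: "u \<bullet> zero_ext S f = (\<Sum>j\<in>S. u $ j * f j)"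
  unfolding inner_vec_def zero_ext_def
  by (simp add: if_distrib[of "(*) _"] sum.If_cases)

text \<open>
  One inclusion is Hoelder's inequality, summed over the groups of an optimal decomposition; for the
  other, a dual ball element is tested against the extremal vectors of Hoelder's inequality in each group.
\<close>

lemma K_set_eq_dual_ball: "K_set q G = seminorm.dual_ball (Omega p G)"
proof -
  interpret seminorm "Omega p G" by (rule seminorm_Omega)
  show ?thesis
  proof (intro set_eqI iffI)
    fix u assume "u \<in> K_set q G"
    then have u: "lp_norm q (G r) (($) u) \<le> 1" for r by (simp add: K_set_def)
    have "u \<bullet> x \<le> Omega p G x" for x
    proof -
      obtain v where v: "P_star G v = x" "Omega p G x = (\<Sum>r\<in>UNIV. lp_norm p (G r) (v r))"
        by (rule Omega_decomposition)
      have "u \<bullet> x = (\<Sum>r\<in>UNIV. \<Sum>j\<in>G r. u $ j * v r j)"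
        by (simp add: v(1)[symmetric] P_star_def inner_sum_right inner_zero_ext)
      also have "\<dots> \<le> (\<Sum>r\<in>UNIV. lp_norm q (G r) (($) u) * lp_norm p (G r) (v r))"
        by (intro sum_mono lp_norm_Holder[OF conjugate_exponents_sym[OF conj]])
      also have "\<dots> \<le> (\<Sum>r\<in>UNIV. 1 * lp_norm p (G r) (v r))"
        by (intro sum_mono mult_right_mono u lp_norm_nonneg)
      finally show ?thesis by (simp add: v(2))
    qed
    then show "u \<in> dual_ball" by (simp add: dual_ball_def)
  next
    fix u assume u: "u \<in> dual_ball"
    have "lp_norm q (G r) (($) u) \<le> 1" for r
    proof -
      obtain f where f: "lp_norm p (G r) f \<le> 1" "(\<Sum>j\<in>G r. u $ j * f j) = lp_norm q (G r) (($) u)"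
        using lp_norm_dual_attained[OF conjugate_exponents_sym[OF conj]] by blast
      have "lp_norm q (G r) (($) u) = u \<bullet> zero_ext (G r) f" by (simp add: inner_zero_ext f(2))
      also have "\<dots> \<le> Omega p G (zero_ext (G r) f)" using u by (simp add: dual_ball_def)
      finally show ?thesis using Omega_single_group[of r f] f(1) by linarith
    qed
    then show "u \<in> K_set q G" by (simp add: K_set_def)
  qed
qed

end

section \<open>Inexact proximal gradient steps\<close>

text \<open>
  The smoothness of \<open>f\<close> is expressed by its affine minorants and quadratic majorants, the two
  inequalities that follow from convexity and from an \<open>L\<close>-Lipschitz gradient \<open>df\<close>.
\<close>

locale composite_objective =
  fixes f g :: "'a::real_inner \<Rightarrow> real" and df :: "'a \<Rightarrow> 'a" and L M :: real
  assumes L_pos: "0 < L" and M_nonneg: "0 \<le> M"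
    and f_nonneg: "0 \<le> f x" and g_nonneg: "0 \<le> g x"
    and f_tangent: "f h + df h \<bullet> (v - h) \<le> f v"
    and f_descent: "f v \<le> f h + df h \<bullet> (v - h) + L / 2 * (norm (v - h))\<^sup>2"
    and g_convex: "convex_on UNIV g"
    and g_lipschitz: "\<bar>g v - g w\<bar> \<le> M * norm (v - w)"
begin

definition E :: "'a \<Rightarrow> real" where
  "E x = f x + g x"

text \<open>
  The optimality condition of
  \<open>z = argmin (\<lambda>v. g v + L / 2 * (norm (v - (h - (1 / L) *\<^sub>R df h)))\<^sup>2)\<close>.
\<close>

definition prox_grad_point :: "'a \<Rightarrow> 'a \<Rightarrow> bool" where
  "prox_grad_point h z \<longleftrightarrow> (\<forall>v. g z + L * ((h - (1 / L) *\<^sub>R df h - z) \<bullet> (v - z)) \<le> g v)"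

lemma E_nonneg: "0 \<le> E x"
  by (simp add: E_def f_nonneg g_nonneg)

lemma E_convex: "convex_on UNIV E"
proof -
  have "convex_on UNIV f"
  proof (intro convex_onI)
    fix t :: real and x y :: 'a assume t: "0 < t" "t < 1"
    let ?a = "(1 - t) *\<^sub>R x + t *\<^sub>R y"
    have "(1 - t) * (f ?a + df ?a \<bullet> (x - ?a)) + t * (f ?a + df ?a \<bullet> (y - ?a))
        \<le> (1 - t) * f x + t * f y"
      using t by (intro add_mono mult_left_mono f_tangent) auto
    moreover have "(1 - t) * (f ?a + df ?a \<bullet> (x - ?a)) + t * (f ?a + df ?a \<bullet> (y - ?a))
        = f ?a + df ?a \<bullet> ((1 - t) *\<^sub>R (x - ?a) + t *\<^sub>R (y - ?a))"
      unfolding inner_add_right inner_scaleR_right by (simp add: algebra_simps)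
    moreover have "(1 - t) *\<^sub>R (x - ?a) + t *\<^sub>R (y - ?a) = 0"
      by (simp add: algebra_simps)
    ultimately show "f ?a \<le> (1 - t) * f x + t * f y" by simp
  qed simp
  from convex_on_add[OF this g_convex] show ?thesis unfolding E_def .
qed

lemma prox_grad_descent:
  assumes "prox_grad_point h z"
  shows "E z + L / 2 * (norm (v - z))\<^sup>2 \<le> E v + L / 2 * (norm (v - h))\<^sup>2"
proof -
  have "g z + L * ((h - (1 / L) *\<^sub>R df h - z) \<bullet> (v - z)) \<le> g v"
    using assms by (simp add: prox_grad_point_def)
  moreover have "L * ((h - (1 / L) *\<^sub>R df h - z) \<bullet> (v - z))
      = L * ((h - z) \<bullet> (v - z)) - df h \<bullet> (v - z)"
    using L_pos by (simp add: inner_diff_left right_diff_distrib)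
  moreover have "df h \<bullet> (v - z) = df h \<bullet> (v - h) - df h \<bullet> (z - h)"
    by (simp add: inner_diff_right)
  moreover have "(norm (v - h))\<^sup>2 - (norm (v - z))\<^sup>2 = (norm (z - h))\<^sup>2 - 2 * ((h - z) \<bullet> (v - z))"
    unfolding power2_norm_eq_inner by (simp add: inner_diff inner_commute)
  then have "L / 2 * ((norm (v - h))\<^sup>2 - (norm (v - z))\<^sup>2)
      = L / 2 * ((norm (z - h))\<^sup>2 - 2 * ((h - z) \<bullet> (v - z)))" by simp
  ultimately show ?thesis
    using f_descent[of z h] f_tangent[of h v] unfolding E_def
    by (simp add: right_diff_distrib)
qed

text \<open>
  A gradient step from \<open>x\<close> decreases \<open>f\<close> by at least \<open>(norm (df x))\<^sup>2 / (2 * L)\<close>, and \<open>f\<close> cannot become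
  negative.
\<close>

lemma gradient_bound: "(norm (df x))\<^sup>2 \<le> 2 * L * f x"
proof -
  have "0 \<le> f (x - (1 / L) *\<^sub>R df x)" by (rule f_nonneg)
  also have "\<dots> \<le> f x + df x \<bullet> (- (1 / L) *\<^sub>R df x) + L / 2 * (norm (- (1 / L) *\<^sub>R df x))\<^sup>2"
    using f_descent[of "x - (1 / L) *\<^sub>R df x" x] by simp
  also have "\<dots> = f x - (norm (df x))\<^sup>2 / (2 * L)"
    using L_pos by (simp add: power2_norm_eq_inner[symmetric] power_divide power2_eq_square
        divide_simps)
  finally show ?thesis using L_pos by (simp add: pos_divide_le_eq mult_ac)
qed

text \<open>
  By \<open>gradient_bound\<close> the slope of \<open>f\<close> at \<open>z\<close> is bounded by an affine function of \<open>E z\<close>, so moving away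
  from \<open>z\<close> costs an amount that is small relative to \<open>1 + E z\<close>, wherever \<open>z\<close> lies.
\<close>

lemma E_perturbed:
  assumes e: "norm e \<le> \<epsilon>"
  shows "E (z + e) \<le> E z + \<epsilon> * (1 / 2 + L * E z + M) + L / 2 * \<epsilon>\<^sup>2"
proof -
  have "0 \<le> (norm (df z) - 1)\<^sup>2" by simp
  also have "\<dots> = (norm (df z))\<^sup>2 - 2 * norm (df z) + 1" by (simp add: power2_diff)
  finally have "norm (df z) \<le> 1 / 2 + L * f z" using gradient_bound[of z] by simp
  also have "\<dots> \<le> 1 / 2 + L * E z" using L_pos g_nonneg[of z] by (simp add: E_def)
  finally have grad: "norm (df z) \<le> 1 / 2 + L * E z" .
  have "df z \<bullet> e \<le> norm (df z) * norm e" by (rule norm_cauchy_schwarz)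
  also have "\<dots> \<le> (1 / 2 + L * E z) * \<epsilon>" using grad e order_trans[OF norm_ge_zero grad] by (intro mult_mono) auto
  finally have "df z \<bullet> e \<le> (1 / 2 + L * E z) * \<epsilon>" .
  moreover have "L / 2 * (norm e)\<^sup>2 \<le> L / 2 * \<epsilon>\<^sup>2"
    using L_pos e by (intro mult_left_mono power_mono) auto
  moreover have "M * norm e \<le> M * \<epsilon>" using M_nonneg e by (intro mult_left_mono) auto
  ultimately show ?thesis
    using f_descent[of "z + e" z] g_lipschitz[of "z + e" z] unfolding E_def[of "z + e"]
    by (simp add: E_def algebra_simps)
qed

text \<open>
  The sum of the constants that \<open>E_perturbed\<close> and the shifted distance produce in
  \<open>potential_perturbed\<close>, where second-order terms are linearized by \<open>\<epsilon>\<^sup>2 \<le> \<epsilon>0 * \<epsilon>\<close>, increased by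
  \<open>1 + L\<close>: the perturbation multiplies the energy gap by \<open>1 + L * \<eta>\<close> and the distance term by
  \<open>1 + \<eta>\<close>, and one constant is to dominate both factors.
\<close>

definition error_const :: "'a \<Rightarrow> real \<Rightarrow> real" where
  "error_const xs \<epsilon>0 = 3 / 2 + 3 / 2 * L + L * E xs + M + L * \<epsilon>0"

lemma error_const_ge: "0 \<le> \<epsilon>0 \<Longrightarrow> 1 + L \<le> error_const xs \<epsilon>0"
proof -
  assume "0 \<le> \<epsilon>0"
  then have "0 \<le> L * E xs" "0 \<le> L * \<epsilon>0" using L_pos E_nonneg[of xs] by simp_all
  then show ?thesis using L_pos M_nonneg unfolding error_const_def by linarith
qed

text \<open>
  The inexactness \<open>e\<close> of a step shifts the distance term by \<open>t *\<^sub>R e\<close>. The effects are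
  of relative size \<open>t * \<epsilon>\<close> or \<open>t\<^sup>2 * \<epsilon>\<close>, because \<open>2 * norm w \<le> 1 + (norm w)\<^sup>2\<close> and because of \<open>E_perturbed\<close>; they are
  absorbed into a factor and a summand governed by \<open>t\<^sup>2 * \<epsilon>\<close>.
\<close>

lemma potential_perturbed:
  assumes min: "\<And>v. E xs \<le> E v"
    and e: "norm e \<le> \<epsilon>" "\<epsilon> \<le> \<epsilon>0" and t: "1 \<le> t"
  shows "t\<^sup>2 * (E (z + e) - E xs) + L / 2 * (norm (w - t *\<^sub>R e))\<^sup>2
    \<le> (1 + error_const xs \<epsilon>0 * (t\<^sup>2 * \<epsilon>)) * (t\<^sup>2 * (E z - E xs) + L / 2 * (norm w)\<^sup>2)
      + error_const xs \<epsilon>0 * (t\<^sup>2 * \<epsilon>)"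
proof -
  define \<eta> where "\<eta> = t\<^sup>2 * \<epsilon>"
  define D where "D = E z - E xs"
  define W where "W = L / 2 * (norm w)\<^sup>2"
  define C where "C = error_const xs \<epsilon>0"
  have \<epsilon>: "0 \<le> \<epsilon>" using e norm_ge_zero order_trans by blast
  have t2: "1 \<le> t\<^sup>2" "t \<le> t\<^sup>2" using t by (simp_all add: self_le_power)
  have \<eta>: "0 \<le> \<eta>" "t * \<epsilon> \<le> \<eta>" using \<epsilon> t2 by (auto simp: \<eta>_def intro: mult_right_mono)
  have D: "0 \<le> D" "D \<le> t\<^sup>2 * D"
    using min[of z] t2 mult_right_mono[of 1 "t\<^sup>2" D] by (auto simp: D_def)
  have W: "0 \<le> W" using L_pos by (simp add: W_def)
  have C: "1 \<le> C" "L \<le> C" using error_const_ge[of \<epsilon>0 xs] e \<epsilon> L_pos by (auto simp: C_def)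
  have "t\<^sup>2 * (E (z + e) - E xs)
      \<le> t\<^sup>2 * (D + \<epsilon> * (1 / 2 + L * (D + E xs) + M) + L / 2 * \<epsilon>\<^sup>2)"
    using E_perturbed[OF e(1), of z] by (intro mult_left_mono) (auto simp: D_def)
  also have "\<dots> = t\<^sup>2 * D + \<eta> * (L * D) + \<eta> * (1 / 2 + L * E xs + M + L / 2 * \<epsilon>)"
    by (simp add: \<eta>_def algebra_simps power2_eq_square)
  finally have 1: "t\<^sup>2 * (E (z + e) - E xs)
      \<le> t\<^sup>2 * D + \<eta> * (L * D) + \<eta> * (1 / 2 + L * E xs + M + L / 2 * \<epsilon>)" .
  have "t * norm e \<le> t * \<epsilon>" using e(1) t by (intro mult_left_mono) auto
  then have "norm (w - t *\<^sub>R e) \<le> norm w + t * \<epsilon>"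
    using norm_triangle_ineq4[of w "t *\<^sub>R e"] t unfolding norm_scaleR by linarith
  then have "(norm (w - t *\<^sub>R e))\<^sup>2 \<le> (norm w + t * \<epsilon>)\<^sup>2"
    by (intro power_mono) auto
  also have "\<dots> = (norm w)\<^sup>2 + t * \<epsilon> * (2 * norm w) + \<eta> * \<epsilon>"
    by (simp add: \<eta>_def power2_eq_square algebra_simps)
  also have "t * \<epsilon> * (2 * norm w) \<le> \<eta> * (1 + (norm w)\<^sup>2)"
  proof (intro mult_mono \<eta>)
    have "0 \<le> (norm w - 1)\<^sup>2" by simp
    then show "2 * norm w \<le> 1 + (norm w)\<^sup>2" by (simp add: power2_diff)
  qed auto
  finally have "(norm (w - t *\<^sub>R e))\<^sup>2 \<le> (norm w)\<^sup>2 + \<eta> * (1 + (norm w)\<^sup>2) + \<eta> * \<epsilon>" by simp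
  then have "L / 2 * (norm (w - t *\<^sub>R e))\<^sup>2
      \<le> L / 2 * ((norm w)\<^sup>2 + \<eta> * (1 + (norm w)\<^sup>2) + \<eta> * \<epsilon>)"
    using L_pos by (intro mult_left_mono) auto
  also have "\<dots> = W + \<eta> * W + \<eta> * (L / 2 + L / 2 * \<epsilon>)"
    by (simp add: W_def algebra_simps)
  finally have 2: "L / 2 * (norm (w - t *\<^sub>R e))\<^sup>2 \<le> W + \<eta> * W + \<eta> * (L / 2 + L / 2 * \<epsilon>)" .
  have "\<eta> * (L * D) \<le> \<eta> * (C * (t\<^sup>2 * D))"
    using C D \<eta> L_pos by (intro mult_left_mono mult_mono) auto
  moreover have "\<eta> * W \<le> \<eta> * (C * W)"
    using C W \<eta> mult_right_mono[of 1 C W] by (intro mult_left_mono) auto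
  moreover have "\<eta> * (1 / 2 + L * E xs + M + L / 2 * \<epsilon>) + \<eta> * (L / 2 + L / 2 * \<epsilon>) \<le> \<eta> * C"
  proof -
    have "L * \<epsilon> \<le> L * \<epsilon>0" using e(2) L_pos by simp
    then have "1 / 2 + L * E xs + M + L / 2 * \<epsilon> + (L / 2 + L / 2 * \<epsilon>) \<le> C"
      using L_pos unfolding C_def error_const_def by linarith
    from mult_left_mono[OF this \<eta>(1)] show ?thesis by (simp add: algebra_simps)
  qed
  ultimately have "t\<^sup>2 * (E (z + e) - E xs) + L / 2 * (norm (w - t *\<^sub>R e))\<^sup>2
      \<le> t\<^sup>2 * D + W + \<eta> * (C * (t\<^sup>2 * D)) + \<eta> * (C * W) + \<eta> * C"
    using 1 2 by linarith
  also have "\<dots> = (1 + C * \<eta>) * (t\<^sup>2 * D + W) + C * \<eta>" by (simp add: algebra_simps)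
  finally show ?thesis by (simp add: C_def D_def W_def \<eta>_def)
qed

end

text \<open>
  The recursion says that \<open>A m + 1\<close> grows by at most the factor \<open>1 + c * \<eta> m \<le> exp (c * \<eta> m)\<close>.
\<close>

lemma discrete_Gronwall:
  fixes A \<eta> :: "nat \<Rightarrow> real"
  assumes step: "\<And>m. A (Suc m) \<le> (1 + c * \<eta> (Suc m)) * A m + c * \<eta> (Suc m)"
    and A0: "0 \<le> A 0" and c: "0 \<le> c" and \<eta>: "\<And>m. 0 \<le> \<eta> m"
    and S: "\<And>m. (\<Sum>i=1..m. \<eta> i) \<le> S"
  shows "A m \<le> (A 0 + 1) * exp (c * S)"
proof -
  have "A m + 1 \<le> (A 0 + 1) * exp (c * (\<Sum>i=1..m. \<eta> i))"
  proof (induction m)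
    case (Suc m)
    have "A (Suc m) + 1 \<le> (1 + c * \<eta> (Suc m)) * (A m + 1)"
      using step[of m] by (simp add: algebra_simps)
    also have "\<dots> \<le> exp (c * \<eta> (Suc m)) * ((A 0 + 1) * exp (c * (\<Sum>i=1..m. \<eta> i)))"
    proof (rule order_trans[OF mult_left_mono[OF Suc.IH] mult_right_mono])
      show "0 \<le> 1 + c * \<eta> (Suc m)" using c \<eta>[of "Suc m"] by simp
      show "1 + c * \<eta> (Suc m) \<le> exp (c * \<eta> (Suc m))" by (rule exp_ge_add_one_self)
      show "0 \<le> (A 0 + 1) * exp (c * (\<Sum>i=1..m. \<eta> i))" using A0 by simp
    qed
    finally show ?case by (simp add: exp_add distrib_left mult_ac)
  qed simp
  also have "\<dots> \<le> (A 0 + 1) * exp (c * S)"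
    using A0 c S[of m] by (intro mult_left_mono) (auto intro: mult_left_mono)
  finally show ?thesis by simp
qed

context composite_objective
begin

text \<open>
  The potential collects the energy gaps of all iterates so far together with the
  current distance to the minimizer; its first part bounds the gap of the average by convexity.
\<close>

theorem inexact_prox_grad_average:
  assumes min: "\<And>v. E xs \<le> E v"
    and step: "\<And>m. \<exists>z. prox_grad_point (x m) z \<and> norm (x (Suc m) - z) \<le> \<epsilon> (Suc m)"
    and \<epsilon>: "\<And>m. 0 \<le> \<epsilon> m" "\<And>m. \<epsilon> m \<le> \<epsilon>0"
    and S: "\<And>m. (\<Sum>i=1..m. \<epsilon> i) \<le> S"
    and m: "1 \<le> m"
  shows "E ((1 / real m) *\<^sub>R (\<Sum>i=1..m. x i)) - E xs
    \<le> (L / 2 * (norm (xs - x 0))\<^sup>2 + 1) * exp (error_const xs \<epsilon>0 * S) / real m"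
proof -
  define C where "C = error_const xs \<epsilon>0"
  define A where "A m = (\<Sum>i=1..m. E (x i) - E xs) + L / 2 * (norm (xs - x m))\<^sup>2" for m
  have C: "0 \<le> C" using error_const_ge[of \<epsilon>0 xs] \<epsilon>[of 0] L_pos by (simp add: C_def)
  have "A (Suc m) \<le> (1 + C * \<epsilon> (Suc m)) * A m + C * \<epsilon> (Suc m)" for m
  proof -
    obtain z where z: "prox_grad_point (x m) z" "norm (x (Suc m) - z) \<le> \<epsilon> (Suc m)"
      using step by blast
    let ?P = "\<Sum>i=1..m. E (x i) - E xs"
    have P: "0 \<le> ?P" using min by (auto intro: sum_nonneg)
    have "(E (x (Suc m)) - E xs) + L / 2 * (norm (xs - x (Suc m)))\<^sup>2
        \<le> (1 + C * \<epsilon> (Suc m)) * ((E z - E xs) + L / 2 * (norm (xs - z))\<^sup>2) + C * \<epsilon> (Suc m)"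
      using potential_perturbed[OF min z(2) \<epsilon>(2), of 1 z "xs - z"] by (simp add: C_def)
    also have "\<dots> \<le> (1 + C * \<epsilon> (Suc m)) * (L / 2 * (norm (xs - x m))\<^sup>2) + C * \<epsilon> (Suc m)"
      using prox_grad_descent[OF z(1), of xs] C \<epsilon>(1)[of "Suc m"]
      by (intro add_right_mono mult_left_mono) auto
    finally have "A (Suc m) \<le> ?P + ((1 + C * \<epsilon> (Suc m)) * (L / 2 * (norm (xs - x m))\<^sup>2) + C * \<epsilon> (Suc m))"
      by (simp add: A_def)
    also have "?P \<le> (1 + C * \<epsilon> (Suc m)) * ?P"
      using P C \<epsilon>(1)[of "Suc m"] by (simp add: distrib_right)
    finally show ?thesis by (simp add: A_def distrib_left)
  qed
  then have "A m \<le> (A 0 + 1) * exp (C * S)"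
    using C \<epsilon>(1) S L_pos by (intro discrete_Gronwall[of A C \<epsilon> S]) (auto simp: A_def)
  moreover have "(\<Sum>i=1..m. E (x i) - E xs) \<le> A m" using L_pos by (simp add: A_def)
  ultimately have bound: "(\<Sum>i=1..m. E (x i) - E xs) \<le> (A 0 + 1) * exp (C * S)" by linarith
  have "E ((1 / real m) *\<^sub>R (\<Sum>i=1..m. x i)) \<le> (\<Sum>i=1..m. 1 / real m * E (x i))"
    unfolding scaleR_sum_right using m
    by (intro convex_on_sum[OF _ _ E_convex]) auto
  also have "\<dots> = (\<Sum>i=1..m. E (x i) - E xs) / real m + E xs"
    using m by (simp add: sum_subtractf sum_divide_distrib[symmetric] diff_divide_distrib)
  also have "\<dots> \<le> (A 0 + 1) * exp (C * S) / real m + E xs"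
    using bound by (intro add_right_mono divide_right_mono) auto
  finally show ?thesis by (simp add: A_def C_def)
qed

end

text \<open>
  The recursion is the positive root of \<open>t\<^sup>2 - t = (s m)\<^sup>2\<close>, which makes the potentials of
  successive accelerated steps telescope.
\<close>

locale nesterov_weights =
  fixes s :: "nat \<Rightarrow> real"
  assumes s_1: "s 1 = 1"
    and s_rec: "1 \<le> m \<Longrightarrow> s (Suc m) = (1 + sqrt (1 + 4 * (s m)\<^sup>2)) / 2"
begin

lemma square_rec: "1 \<le> m \<Longrightarrow> (s (Suc m))\<^sup>2 - s (Suc m) = (s m)\<^sup>2"
  using real_sqrt_pow2[of "1 + 4 * (s m)\<^sup>2"] by (simp add: s_rec power2_eq_square field_simps)

lemma bounds: "1 \<le> m \<Longrightarrow> (real m + 1) / 2 \<le> s m \<and> s m \<le> real m"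
proof (induction m rule: nat_induct_at_least)
  case (Suc m)
  then have s: "(real m + 1) / 2 \<le> s m" "s m \<le> real m" "0 \<le> s m" by auto
  have "2 * s m \<le> sqrt (1 + 4 * (s m)\<^sup>2)"
    by (rule real_le_rsqrt) (simp add: power_mult_distrib)
  moreover have "sqrt (1 + 4 * (s m)\<^sup>2) \<le> 1 + 2 * s m"
    using s by (intro real_le_lsqrt) (auto simp: power2_sum power_mult_distrib)
  ultimately show ?case using s s_rec[OF Suc.hyps] by simp
qed (use s_1 in simp)

lemma ge_1: "1 \<le> m \<Longrightarrow> 1 \<le> s m"
  using bounds[of m] by auto

end

context composite_objective
begin

text \<open>
  The descent inequality is tested at the convex combination of the previous iterate \<open>x\<close> and the
  minimizer \<open>xs\<close> with weight \<open>1 / t\<close> on \<open>xs\<close>, and multiplied by \<open>t\<^sup>2\<close>. The hypothesis on \<open>h\<close> says that the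
  extrapolation is chosen so that, at scale \<open>t\<close>, the distances on both sides are those of \<open>xs\<close> to an
  auxiliary sequence \<open>u\<close>.
\<close>

lemma accelerated_descent:
  assumes z: "prox_grad_point h z" and t: "1 \<le> t"
    and h: "t *\<^sub>R h = (t - 1) *\<^sub>R x + u"
  shows "t\<^sup>2 * (E z - E xs) + L / 2 * (norm (xs - (t *\<^sub>R z - (t - 1) *\<^sub>R x)))\<^sup>2
    \<le> (t\<^sup>2 - t) * (E x - E xs) + L / 2 * (norm (xs - u))\<^sup>2"
proof -
  define v where "v = (1 - 1 / t) *\<^sub>R x + (1 / t) *\<^sub>R xs"
  have tv: "t *\<^sub>R v = (t - 1) *\<^sub>R x + xs"
    using t by (simp add: v_def scaleR_add_right right_diff_distrib)
  have "E v \<le> (1 - 1 / t) * E x + 1 / t * E xs"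
    unfolding v_def using t convex_onD[OF E_convex, of "1 / t" x xs] by simp
  then have "E z + L / 2 * (norm (v - z))\<^sup>2
      \<le> (1 - 1 / t) * E x + 1 / t * E xs + L / 2 * (norm (v - h))\<^sup>2"
    using prox_grad_descent[OF z, of v] by linarith
  then have "t\<^sup>2 * (E z + L / 2 * (norm (v - z))\<^sup>2)
      \<le> t\<^sup>2 * ((1 - 1 / t) * E x + 1 / t * E xs + L / 2 * (norm (v - h))\<^sup>2)"
    by (intro mult_left_mono) auto
  moreover have "t\<^sup>2 * ((1 - 1 / t) * E x + 1 / t * E xs) = (t\<^sup>2 - t) * E x + t * E xs"
    using t by (simp add: field_simps power2_eq_square)
  moreover have "t\<^sup>2 * (norm (v - h))\<^sup>2 = (norm (xs - u))\<^sup>2"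
  proof -
    have "t *\<^sub>R (v - h) = xs - u" using tv h by (simp add: scaleR_diff_right)
    then have "norm (xs - u) = t * norm (v - h)"
      using t by (metis abs_of_nonneg norm_scaleR order_trans zero_le_one)
    then show ?thesis by (simp add: power_mult_distrib)
  qed
  moreover have "t\<^sup>2 * (norm (v - z))\<^sup>2 = (norm (xs - (t *\<^sub>R z - (t - 1) *\<^sub>R x)))\<^sup>2"
  proof -
    have "t *\<^sub>R (v - z) = xs - (t *\<^sub>R z - (t - 1) *\<^sub>R x)"
      using tv by (simp add: scaleR_diff_right)
    then have "norm (xs - (t *\<^sub>R z - (t - 1) *\<^sub>R x)) = t * norm (v - z)"
      using t by (metis abs_of_nonneg norm_scaleR order_trans zero_le_one)
    then show ?thesis by (simp add: power_mult_distrib)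
  qed
  ultimately show ?thesis by (simp add: algebra_simps)
qed

text \<open>
  The weight \<open>(s m)\<^sup>2\<close> of the energy gap is inherited by the next step as \<open>s (Suc m)\<^sup>2 - s (Suc m)\<close>.
  Before the first step this weight is \<open>s 1 ^ 2 - s 1 = 0\<close>, which explains the value of the potential at
  \<open>0\<close>.
\<close>

theorem inexact_accelerated_prox_grad:
  assumes min: "\<And>v. E xs \<le> E v"
    and weights: "nesterov_weights s"
    and h1: "h 1 = x 0"
    and h_rec: "\<And>m. 1 \<le> m \<Longrightarrow> h (Suc m) = (1 + (s m - 1) / s (Suc m)) *\<^sub>R x m
                      + ((1 - s m) / s (Suc m)) *\<^sub>R x (m - 1)"
    and step: "\<And>m. 1 \<le> m \<Longrightarrow> \<exists>z. prox_grad_point (h m) z \<and> norm (x m - z) \<le> \<epsilon> m"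
    and \<epsilon>: "\<And>m. 0 \<le> \<epsilon> m" "\<And>m. \<epsilon> m \<le> \<epsilon>0"
    and S: "\<And>m. (\<Sum>i=1..m. (real i)\<^sup>2 * \<epsilon> i) \<le> S"
    and m: "1 \<le> m"
  shows "E (x m) - E xs
    \<le> 4 * (L / 2 * (norm (xs - x 0))\<^sup>2 + 1) * exp (error_const xs \<epsilon>0 * S) / (real m)\<^sup>2"
proof -
  interpret nesterov_weights s by (rule weights)
  define C where "C = error_const xs \<epsilon>0"
  define u where "u m = (if m = 0 then x 0 else s m *\<^sub>R x m - (s m - 1) *\<^sub>R x (m - 1))" for m
  define A where
    "A m = (if m = 0 then 0 else (s m)\<^sup>2 * (E (x m) - E xs)) + L / 2 * (norm (xs - u m))\<^sup>2" for m
  have C: "0 \<le> C" using error_const_ge[of \<epsilon>0 xs] \<epsilon>[of 0] L_pos by (simp add: C_def)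
  have "A (Suc m) \<le> (1 + C * ((real (Suc m))\<^sup>2 * \<epsilon> (Suc m))) * A m + C * ((real (Suc m))\<^sup>2 * \<epsilon> (Suc m))"
    for m
  proof -
    let ?t = "s (Suc m)"
    let ?B = "(?t\<^sup>2 - ?t) * (E (x m) - E xs) + L / 2 * (norm (xs - u m))\<^sup>2"
    obtain z where z: "prox_grad_point (h (Suc m)) z" "norm (x (Suc m) - z) \<le> \<epsilon> (Suc m)"
      using step[of "Suc m"] by auto
    have t: "1 \<le> ?t" "?t \<le> real (Suc m)" using ge_1[of "Suc m"] bounds[of "Suc m"] by auto
    have h: "?t *\<^sub>R h (Suc m) = (?t - 1) *\<^sub>R x m + u m"
    proof (cases "m = 0")
      case False
      have "?t *\<^sub>R h (Suc m) = (?t + (s m - 1)) *\<^sub>R x m + (1 - s m) *\<^sub>R x (m - 1)"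
        using t(1) False by (simp add: h_rec scaleR_add_right distrib_left)
      then show ?thesis using False by (simp add: u_def algebra_simps)
    qed (use h1 s_1 in \<open>simp add: u_def\<close>)
    have B: "?B = A m"
      using s_1 square_rec[of m] by (cases "m = 0") (simp_all add: A_def)
    define w where "w = xs - (?t *\<^sub>R z - (?t - 1) *\<^sub>R x m)"
    define \<eta> where "\<eta> = (real (Suc m))\<^sup>2 * \<epsilon> (Suc m)"
    have \<eta>: "?t\<^sup>2 * \<epsilon> (Suc m) \<le> \<eta>"
      unfolding \<eta>_def using t \<epsilon>(1) by (intro mult_right_mono power_mono) auto
    have "w - ?t *\<^sub>R (x (Suc m) - z) = xs - u (Suc m)"
      by (simp add: w_def u_def scaleR_diff_right)
    then have "A (Suc m) \<le> (1 + C * (?t\<^sup>2 * \<epsilon> (Suc m))) * (?t\<^sup>2 * (E z - E xs) + L / 2 * (norm w)\<^sup>2)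
        + C * (?t\<^sup>2 * \<epsilon> (Suc m))"
      using potential_perturbed[OF min z(2) \<epsilon>(2) t(1), of z w] by (simp add: A_def C_def)
    also have "\<dots> \<le> (1 + C * \<eta>) * A m + C * \<eta>"
    proof (intro add_mono mult_mono)
      show "?t\<^sup>2 * (E z - E xs) + L / 2 * (norm w)\<^sup>2 \<le> A m"
        using accelerated_descent[OF z(1) t(1) h, of xs] B by (simp add: w_def)
      show "0 \<le> ?t\<^sup>2 * (E z - E xs) + L / 2 * (norm w)\<^sup>2"
        using min[of z] L_pos by simp
      show "0 \<le> 1 + C * \<eta>" using C \<epsilon>(1)[of "Suc m"] by (simp add: \<eta>_def)
    qed (use C \<eta> \<epsilon>(1)[of "Suc m"] in auto)
    finally show ?thesis by (simp add: \<eta>_def)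
  qed
  then have "A m \<le> (A 0 + 1) * exp (C * S)"
    using C \<epsilon>(1) S L_pos
    by (intro discrete_Gronwall[of A C "\<lambda>m. (real m)\<^sup>2 * \<epsilon> m" S]) (auto simp: A_def)
  moreover have "(s m)\<^sup>2 * (E (x m) - E xs) \<le> A m" using L_pos m by (simp add: A_def)
  moreover have "(real m / 2)\<^sup>2 * (E (x m) - E xs) \<le> (s m)\<^sup>2 * (E (x m) - E xs)"
    using bounds[OF m] min[of "x m"] by (intro mult_right_mono power_mono) auto
  ultimately have "(real m / 2)\<^sup>2 * (E (x m) - E xs) \<le> (A 0 + 1) * exp (C * S)" by linarith
  then have "E (x m) - E xs \<le> 4 * ((A 0 + 1) * exp (C * S)) / (real m)\<^sup>2"
    using m by (simp add: power_divide pos_le_divide_eq mult_ac)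
  moreover have "A 0 = L / 2 * (norm (xs - x 0))\<^sup>2" by (simp add: A_def u_def)
  ultimately show ?thesis by (simp only: C_def mult.assoc)
qed

end

section \<open>Least squares with the group penalty\<close>

lemma norm_square_le_step_const:
  fixes \<Psi> :: "real^'d::finite \<Rightarrow> real^'n::finite"
  assumes "linear \<Psi>"
  shows "(norm (\<Psi> v))\<^sup>2 \<le> real CARD('n) * step_const \<Psi> * (norm v)\<^sup>2"
proof -
  have bl: "bounded_linear (adjoint \<Psi> \<circ> \<Psi>)"
    using assms by (simp add: linear_conv_bounded_linear[symmetric] linear_compose adjoint_linear)
  have "(norm (\<Psi> v))\<^sup>2 = v \<bullet> (adjoint \<Psi> \<circ> \<Psi>) v"
    by (simp add: power2_norm_eq_inner adjoint_works[OF assms])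
  also have "\<dots> \<le> norm v * norm ((adjoint \<Psi> \<circ> \<Psi>) v)" by (rule norm_cauchy_schwarz)
  also have "\<dots> \<le> norm v * (onorm (adjoint \<Psi> \<circ> \<Psi>) * norm v)"
    by (intro mult_left_mono onorm[OF bl]) auto
  finally show ?thesis by (simp add: step_const_def power2_eq_square mult_ac)
qed

lemma step_const_pos:
  fixes \<Psi> :: "real^'d::finite \<Rightarrow> real^'n::finite"
  assumes "linear \<Psi>" "\<Psi> \<noteq> (\<lambda>_. 0)"
  shows "0 < step_const \<Psi>"
proof -
  obtain v where "\<Psi> v \<noteq> 0" using assms(2) by auto
  then have "0 < (norm (\<Psi> v))\<^sup>2" by simp
  also note norm_square_le_step_const[OF assms(1), of v]
  finally have *: "0 < real CARD('n) * step_const \<Psi> * (norm v)\<^sup>2" .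
  have "0 \<le> real CARD('n) * (norm v)\<^sup>2" by simp
  with * show ?thesis by (auto simp: zero_less_mult_iff)
qed

text \<open>
  The data term is quadratic, so its second-order Taylor expansion is exact.
\<close>

lemma least_squares_expansion:
  fixes \<Psi> :: "real^'d::finite \<Rightarrow> real^'n::finite"
  assumes "linear \<Psi>"
  shows "(norm (\<Psi> v - y))\<^sup>2
    = (norm (\<Psi> h - y))\<^sup>2 + 2 * (adjoint \<Psi> (\<Psi> h - y) \<bullet> (v - h)) + (norm (\<Psi> (v - h)))\<^sup>2"
proof -
  have "\<Psi> v - y = (\<Psi> h - y) + \<Psi> (v - h)" by (simp add: linear_diff[OF assms])
  moreover have "adjoint \<Psi> (\<Psi> h - y) \<bullet> (v - h) = (\<Psi> h - y) \<bullet> \<Psi> (v - h)"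
    using adjoint_works[OF assms, of "v - h" "\<Psi> h - y"] by (simp add: inner_commute)
  ultimately show ?thesis
    by (simp only: power2_norm_eq_inner) (simp add: inner_add inner_commute)
qed

lemma composite_objective_energy:
  fixes \<Psi> :: "real^'d::finite \<Rightarrow> real^'n::finite" and G :: "'b::finite \<Rightarrow> 'd set"
  assumes lin: "linear \<Psi>" and nz: "\<Psi> \<noteq> (\<lambda>_. 0)" and \<tau>: "0 < \<tau>"
    and conj: "conjugate_exponents p q" and cover: "(\<Union>r. G r) = UNIV"
  shows "composite_objective (\<lambda>x. 1 / real CARD('n) * (norm (\<Psi> x - y))\<^sup>2) (\<lambda>x. 2 * \<tau> * Omega p G x)
    (\<lambda>x. (2 / real CARD('n)) *\<^sub>R adjoint \<Psi> (\<Psi> x - y))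
    (2 * step_const \<Psi>) (2 * \<tau> * seminorm.lipschitz_const (Omega p G))"
proof -
  interpret N: seminorm "Omega p G" by (rule seminorm_Omega[OF conj cover])
  have exp: "1 / real CARD('n) * (norm (\<Psi> v - y))\<^sup>2
      = 1 / real CARD('n) * (norm (\<Psi> h - y))\<^sup>2
        + (2 / real CARD('n)) *\<^sub>R adjoint \<Psi> (\<Psi> h - y) \<bullet> (v - h)
        + 1 / real CARD('n) * (norm (\<Psi> (v - h)))\<^sup>2" for v h
    unfolding least_squares_expansion[OF lin, of v y h] by (simp add: field_simps)
  show ?thesis
  proof
    show "0 < 2 * step_const \<Psi>" using step_const_pos[OF lin nz] by simp
    show "0 \<le> 2 * \<tau> * N.lipschitz_const" using \<tau> N.lipschitz_const_nonneg by simp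
    show "0 \<le> 1 / real CARD('n) * (norm (\<Psi> x - y))\<^sup>2" for x by simp
    show "0 \<le> 2 * \<tau> * Omega p G x" for x using \<tau> N.nonneg by simp
    show "1 / real CARD('n) * (norm (\<Psi> h - y))\<^sup>2
        + (2 / real CARD('n)) *\<^sub>R adjoint \<Psi> (\<Psi> h - y) \<bullet> (v - h)
        \<le> 1 / real CARD('n) * (norm (\<Psi> v - y))\<^sup>2" for h v
      unfolding exp[of v h] by simp
    show "1 / real CARD('n) * (norm (\<Psi> v - y))\<^sup>2
        \<le> 1 / real CARD('n) * (norm (\<Psi> h - y))\<^sup>2
          + (2 / real CARD('n)) *\<^sub>R adjoint \<Psi> (\<Psi> h - y) \<bullet> (v - h)
          + 2 * step_const \<Psi> / 2 * (norm (v - h))\<^sup>2" for h v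
      unfolding exp[of v h] using norm_square_le_step_const[OF lin, of "v - h"]
      by (simp add: pos_divide_le_eq mult_ac)
    show "convex_on UNIV (\<lambda>x. 2 * \<tau> * Omega p G x)"
      using \<tau> N.convex_on by (intro convex_on_cmul) auto
    show "\<bar>2 * \<tau> * Omega p G v - 2 * \<tau> * Omega p G w\<bar>
        \<le> 2 * \<tau> * N.lipschitz_const * norm (v - w)" for v w
      using mult_left_mono[OF N.lipschitz[of v w], of "2 * \<tau>"] \<tau>
      by (simp add: right_diff_distrib[symmetric] abs_mult mult.assoc)
  qed
qed

text \<open>
  The index \<open>i = 0\<close> contributes \<open>0 powr (- a) = 0\<close> to the full series, so starting at \<open>1\<close> loses nothing.
\<close>

lemma partial_sums_powr_bounded:
  assumes "1 < a"
  obtains S where "\<And>m. (\<Sum>i=1..m. c / real i powr a) \<le> (S::real)"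
proof -
  define C where "C = \<bar>c\<bar>"
  have sm: "summable (\<lambda>i. C * real i powr (- a))"
    using assms by (intro summable_mult) (simp add: summable_real_powr_iff)
  have "(\<Sum>i=1..m. c / real i powr a) \<le> (\<Sum>i. C * real i powr (- a))" for m
  proof -
    have "(\<Sum>i=1..m. c / real i powr a) \<le> (\<Sum>i=1..m. C * real i powr (- a))"
      by (intro sum_mono) (simp add: powr_minus divide_inverse C_def mult_right_mono)
    also have "\<dots> \<le> (\<Sum>i. C * real i powr (- a))"
      using sm by (rule sum_le_suminf) (auto simp: C_def)
    finally show ?thesis .
  qed
  then show thesis by (rule that)
qed

theorem theorem2:
  fixes \<Psi> :: "real^'d::finite \<Rightarrow> real^'n::finite"
    and y :: "real^'n"
    and G :: "'b::finite \<Rightarrow> 'd set"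
    and p q :: ereal
    and \<tau> \<sigma> \<alpha> \<epsilon>0 :: real
    and x0 :: "real^'d"
  assumes "linear \<Psi>" and "\<Psi> \<noteq> (\<lambda>_. 0)"
    and "\<tau> > 0"
    and "1 < p" and "1 / p + 1 / q = 1"
    and "(\<Union>r. G r) = UNIV"
    and "\<sigma> = step_const \<Psi>"
    and "\<epsilon>0 > 0" and "\<alpha> > 0"
  shows "(\<alpha> > 2 \<longrightarrow>
      (\<exists>C_I. \<forall>xstar. (\<forall>z. energy \<Psi> y \<tau> p G xstar \<le> energy \<Psi> y \<tau> p G z) \<longrightarrow>
        (\<forall>x. inexact_ISTA \<Psi> y \<tau> \<sigma> q G (\<lambda>m. \<epsilon>0 / real m powr \<alpha>) x0 x \<longrightarrow>
          (\<forall>m\<ge>1. energy \<Psi> y \<tau> p G ((1 / real m) *\<^sub>R (\<Sum>i=1..m. x i))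
                    - energy \<Psi> y \<tau> p G xstar \<le> C_I / real m)))) \<and>
    (\<alpha> > 4 \<longrightarrow>
      (\<exists>C_F. \<forall>xstar. (\<forall>z. energy \<Psi> y \<tau> p G xstar \<le> energy \<Psi> y \<tau> p G z) \<longrightarrow>
        (\<forall>x. inexact_FISTA \<Psi> y \<tau> \<sigma> q G (\<lambda>m. \<epsilon>0 / real m powr \<alpha>) x0 x \<longrightarrow>
          (\<forall>m\<ge>1. energy \<Psi> y \<tau> p G (x m)
                    - energy \<Psi> y \<tau> p G xstar \<le> C_F / (real m)\<^sup>2))))"
proof (cases "\<exists>xs. \<forall>z. energy \<Psi> y \<tau> p G xs \<le> energy \<Psi> y \<tau> p G z")
  case False
  then show ?thesis by blast
next
  case True
  then obtain xs where xs: "\<And>z. energy \<Psi> y \<tau> p G xs \<le> energy \<Psi> y \<tau> p G z" by blast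
  have conj: "conjugate_exponents p q" using assms by (intro conjugate_exponentsI) auto
  have \<sigma>: "0 < \<sigma>" using step_const_pos assms by simp
  interpret N: seminorm "Omega p G" by (rule seminorm_Omega[OF conj]) (rule assms)
  interpret composite_objective "\<lambda>x. 1 / real CARD('n) * (norm (\<Psi> x - y))\<^sup>2"
    "\<lambda>x. 2 * \<tau> * Omega p G x" "\<lambda>x. (2 / real CARD('n)) *\<^sub>R adjoint \<Psi> (\<Psi> x - y)"
    "2 * \<sigma>" "2 * \<tau> * N.lipschitz_const"
    unfolding \<open>\<sigma> = step_const \<Psi>\<close> by (rule composite_objective_energy[OF _ _ _ conj]) (rule assms)+
  have E: "E = energy \<Psi> y \<tau> p G" by (rule ext) (simp only: E_def energy_def)
  have min: "E xs \<le> E v" for v unfolding E by (rule xs)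
  have E_min: "energy \<Psi> y \<tau> p G xstar = E xs"
    if "\<forall>z. energy \<Psi> y \<tau> p G xstar \<le> energy \<Psi> y \<tau> p G z" for xstar
    unfolding E using that xs by (blast intro: antisym)
  \<comment> \<open>The value at \<open>m = 0\<close> is \<open>\<epsilon>0 / 0 = 0\<close>, which respects the bounds below.\<close>
  define \<epsilon> where "\<epsilon> m = \<epsilon>0 / real m powr \<alpha>" for m
  have \<epsilon>_nonneg: "0 \<le> \<epsilon> m" for m using assms by (simp add: \<epsilon>_def)
  have \<epsilon>_le: "\<epsilon> m \<le> \<epsilon>0" for m
  proof (cases "m = 0")
    case False
    then have "1 \<le> real m powr \<alpha>" using assms by (intro ge_one_powr_ge_zero) auto
    then have "\<epsilon>0 * 1 \<le> \<epsilon>0 * real m powr \<alpha>" using assms by (intro mult_left_mono) auto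
    then show ?thesis using False by (simp add: \<epsilon>_def pos_divide_le_eq)
  qed (use assms in \<open>simp add: \<epsilon>_def\<close>)
  \<comment> \<open>Division by \<open>2 * \<sigma>\<close> turns the weight \<open>2 * \<tau>\<close> of the penalty into the radius \<open>\<tau> / \<sigma>\<close>
    of the dual ball that is projected onto.\<close>
  have exact: "\<exists>z. prox_grad_point h z \<and> norm (x - z) \<le> e"
    if w: "approx_projection ((*\<^sub>R) (\<tau> / \<sigma>) ` K_set q G) (grad_step \<Psi> y \<sigma> h) e w"
      and x: "x = grad_step \<Psi> y \<sigma> h - w" for h x w e
  proof -
    define b where "b = grad_step \<Psi> y \<sigma> h"
    define z where "z = b - closest_point ((*\<^sub>R) (\<tau> / \<sigma>) ` N.dual_ball) b"
    have b: "b = h - (1 / (2 * \<sigma>)) *\<^sub>R (2 / real CARD('n)) *\<^sub>R adjoint \<Psi> (\<Psi> h - y)"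
      by (simp add: b_def grad_step_def mult.commute)
    have "prox_grad_point h z"
      unfolding prox_grad_point_def b[symmetric]
    proof
      fix v
      have "\<tau> / \<sigma> * Omega p G z + (b - z) \<bullet> (v - z) \<le> \<tau> / \<sigma> * Omega p G v"
        unfolding z_def using assms \<sigma> by (intro N.dual_projection_is_prox) simp
      then have "2 * \<sigma> * (\<tau> / \<sigma> * Omega p G z + (b - z) \<bullet> (v - z)) \<le> 2 * \<sigma> * (\<tau> / \<sigma> * Omega p G v)"
        using \<sigma> by (intro mult_left_mono) auto
      then show "2 * \<tau> * Omega p G z + 2 * \<sigma> * ((b - z) \<bullet> (v - z)) \<le> 2 * \<tau> * Omega p G v"
        using \<sigma> by (simp add: distrib_left)
    qed
    moreover have "norm (x - z) \<le> e"
      using w K_set_eq_dual_ball[OF conj assms(6)]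
      by (simp add: x z_def b_def approx_projection_def norm_minus_commute)
    ultimately show ?thesis by blast
  qed
  show ?thesis
  proof (intro conjI impI)
    assume "\<alpha> > 2"
    then obtain S where S: "\<And>m. (\<Sum>i=1..m. \<epsilon> i) \<le> S"
      using partial_sums_powr_bounded[of \<alpha> \<epsilon>0] unfolding \<epsilon>_def by auto
    show "\<exists>C_I. \<forall>xstar. (\<forall>z. energy \<Psi> y \<tau> p G xstar \<le> energy \<Psi> y \<tau> p G z) \<longrightarrow>
        (\<forall>x. inexact_ISTA \<Psi> y \<tau> \<sigma> q G (\<lambda>m. \<epsilon>0 / real m powr \<alpha>) x0 x \<longrightarrow>
          (\<forall>m\<ge>1. energy \<Psi> y \<tau> p G ((1 / real m) *\<^sub>R (\<Sum>i=1..m. x i))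
                    - energy \<Psi> y \<tau> p G xstar \<le> C_I / real m))"
    proof (intro exI allI impI)
      fix xstar x m
      assume xstar: "\<forall>z. energy \<Psi> y \<tau> p G xstar \<le> energy \<Psi> y \<tau> p G z" and m: "1 \<le> (m::nat)"
        and ista: "inexact_ISTA \<Psi> y \<tau> \<sigma> q G (\<lambda>m. \<epsilon>0 / real m powr \<alpha>) x0 x"
      from ista obtain w where x0: "x 0 = x0" and w: "\<And>m. 1 \<le> m \<Longrightarrow>
          approx_projection ((*\<^sub>R) (\<tau> / \<sigma>) ` K_set q G) (grad_step \<Psi> y \<sigma> (x (m - 1))) (\<epsilon> m) (w m)"
        "\<And>m. 1 \<le> m \<Longrightarrow> x m = grad_step \<Psi> y \<sigma> (x (m - 1)) - w m"
        unfolding inexact_ISTA_def Let_def \<epsilon>_def by blast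
      have "\<exists>z. prox_grad_point (x m) z \<and> norm (x (Suc m) - z) \<le> \<epsilon> (Suc m)" for m
        using exact[OF w(1)[of "Suc m"] w(2)[of "Suc m"]] by simp
      from inexact_prox_grad_average[OF min this \<epsilon>_nonneg \<epsilon>_le S m]
      show "energy \<Psi> y \<tau> p G ((1 / real m) *\<^sub>R (\<Sum>i=1..m. x i)) - energy \<Psi> y \<tau> p G xstar
          \<le> (2 * \<sigma> / 2 * (norm (xs - x0))\<^sup>2 + 1) * exp (error_const xs \<epsilon>0 * S) / real m"
        unfolding E_min[OF xstar] x0 E .
    qed
  next
    assume "\<alpha> > 4"
    then obtain S where S: "\<And>m. (\<Sum>i=1..m. \<epsilon>0 / real i powr (\<alpha> - 2)) \<le> S"
      using partial_sums_powr_bounded[of "\<alpha> - 2" \<epsilon>0] by auto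
    have "(real i)\<^sup>2 * \<epsilon> i = \<epsilon>0 / real i powr (\<alpha> - 2)" if "1 \<le> i" for i
      using that by (simp add: \<epsilon>_def powr_diff)
    then have S: "(\<Sum>i=1..m. (real i)\<^sup>2 * \<epsilon> i) \<le> S" for m
      using S[of m] by simp
    show "\<exists>C_F. \<forall>xstar. (\<forall>z. energy \<Psi> y \<tau> p G xstar \<le> energy \<Psi> y \<tau> p G z) \<longrightarrow>
        (\<forall>x. inexact_FISTA \<Psi> y \<tau> \<sigma> q G (\<lambda>m. \<epsilon>0 / real m powr \<alpha>) x0 x \<longrightarrow>
          (\<forall>m\<ge>1. energy \<Psi> y \<tau> p G (x m) - energy \<Psi> y \<tau> p G xstar \<le> C_F / (real m)\<^sup>2))"
    proof (intro exI allI impI)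
      fix xstar x m
      assume xstar: "\<forall>z. energy \<Psi> y \<tau> p G xstar \<le> energy \<Psi> y \<tau> p G z" and m: "1 \<le> (m::nat)"
        and fista: "inexact_FISTA \<Psi> y \<tau> \<sigma> q G (\<lambda>m. \<epsilon>0 / real m powr \<alpha>) x0 x"
      from fista obtain w h s where x0: "x 0 = x0" and h1: "h 1 = x0" and s1: "s 1 = 1"
        and w: "\<And>m. 1 \<le> m \<Longrightarrow>
          approx_projection ((*\<^sub>R) (\<tau> / \<sigma>) ` K_set q G) (grad_step \<Psi> y \<sigma> (h m)) (\<epsilon> m) (w m)"
          "\<And>m. 1 \<le> m \<Longrightarrow> x m = grad_step \<Psi> y \<sigma> (h m) - w m"
        and s: "\<And>m. 1 \<le> m \<Longrightarrow> s (m + 1) = (1 + sqrt (1 + 4 * (s m)\<^sup>2)) / 2"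
        and h: "\<And>m. 1 \<le> m \<Longrightarrow> h (m + 1) = (1 + (s m - 1) / s (m + 1)) *\<^sub>R x m
                      + ((1 - s m) / s (m + 1)) *\<^sub>R x (m - 1)"
        unfolding inexact_FISTA_def Let_def \<epsilon>_def by blast
      have weights: "nesterov_weights s" using s1 s by unfold_locales auto
      have h1: "h 1 = x 0" using h1 x0 by simp
      have h': "h (Suc m) = (1 + (s m - 1) / s (Suc m)) *\<^sub>R x m
          + ((1 - s m) / s (Suc m)) *\<^sub>R x (m - 1)" if "1 \<le> m" for m
        using h[OF that] by simp
      have "\<exists>z. prox_grad_point (h m) z \<and> norm (x m - z) \<le> \<epsilon> m" if "1 \<le> m" for m
        by (rule exact[OF w(1)[OF that] w(2)[OF that]])
      from inexact_accelerated_prox_grad[OF min weights h1 h' this \<epsilon>_nonneg \<epsilon>_le S m]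
      show "energy \<Psi> y \<tau> p G (x m) - energy \<Psi> y \<tau> p G xstar
          \<le> 4 * (2 * \<sigma> / 2 * (norm (xs - x0))\<^sup>2 + 1) * exp (error_const xs \<epsilon>0 * S) / (real m)\<^sup>2"
        unfolding E_min[OF xstar] x0 E .
    qed
  qed
qed

end
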